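(* Let $\kappa$ be a strong limit cardinal with $\mathrm{cf}(\kappa)=\omega$, and suppose $\lambda=\kappa^+=2^\kappa$. Let ${}^*V$ be a $\lambda$-saturated nonstandard universe with $|{}^*\mathbb{N}|=\lambda$. Then every hyperfinite Loeb space in ${}^*V$ is compact.
   Context: Work in ZFC. The standard universe $V$ is built over $\mathbb{N}$: $V_0=\mathbb{N}$, $V_{n+1}=V_n\cup\mathcal{P}(V_n)$, $V=\bigcup_n V_n$. A nonstandard universe ${}^*V$ is the truncation at ${}^*\!\in$-rank $\omega$ of an elementary extension of $(V,\in)$ with ${}^*\mathbb{N}\setminus\mathbb{N}\neq\emptyset$, always assumed $\omega_1$-saturated. A hyperfinite Loeb space: for $H\in{}^*\mathbb{N}\setminus\mathbb{N}$, $\Omega=\{1,\dots,H\}$, $P(A)={}^*|A|/H$ for internal $A\subseteq\Omega$; $(\Omega,\Sigma,L_P)$ is the Loeb measure space generated by the internal subsets and $\mathrm{st}\circ P$ (completed). A family $\mathcal{C}\subseteq\Sigma$ is compact if every subfamily with the finite intersection property has nonempty intersection, and inner-regular if $L_P(A)=\sup\{L_P(C):C\subseteq A,\ C\in\mathcal{C}\}$ for all $A\in\Sigma$. $\Omega$ is compact if it carries an inner-regular compact family. *)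

theory Defs
  imports "HOL-Analysis.Analysis"
begin

unbundle cardinal_syntax


section \<open>Cardinals\<close>

definition strong_limit :: "'k rel \<Rightarrow> bool" where
  "strong_limit \<kappa> \<longleftrightarrow> Card_order \<kappa> \<and> cinfinite \<kappa> \<and>
     (\<forall>A \<subseteq> Field \<kappa>. |A| <o \<kappa> \<longrightarrow> ctwo ^c |A| <o \<kappa>)"

text \<open>\<^const>\<open>cofinal\<close> is strict: \<open>cofinal A \<kappa>\<close> says that every element of \<open>Field \<kappa>\<close> lies strictly
  below an element of \<open>A\<close>. For infinite cardinals this agrees with the usual notion.\<close>

definition has_cofinality :: "'k rel \<Rightarrow> 'm rel \<Rightarrow> bool" where
  "has_cofinality \<kappa> \<mu> \<longleftrightarrow>
     (\<exists>A \<subseteq> Field \<kappa>. cofinal A \<kappa> \<and> |A| =o \<mu>) \<and>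
     (\<forall>A \<subseteq> Field \<kappa>. cofinal A \<kappa> \<longrightarrow> \<mu> \<le>o |A| )"


section \<open>Compact families and compact measure spaces\<close>

definition fip :: "'a set set \<Rightarrow> bool" where
  "fip \<D> \<longleftrightarrow> (\<forall>F \<subseteq> \<D>. finite F \<longrightarrow> \<Inter>F \<noteq> {})"

definition compact_family :: "'a set set \<Rightarrow> bool" where
  "compact_family \<C> \<longleftrightarrow> (\<forall>\<D> \<subseteq> \<C>. fip \<D> \<longrightarrow> \<Inter>\<D> \<noteq> {})"

definition inner_regular_family :: "'a measure \<Rightarrow> 'a set set \<Rightarrow> bool" where
  "inner_regular_family M \<C> \<longleftrightarrow>
     (\<forall>A \<in> sets M. emeasure M A = (SUP C \<in> {C \<in> \<C>. C \<subseteq> A}. emeasure M C))"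

definition compact_measure_space :: "'a measure \<Rightarrow> bool" where
  "compact_measure_space M \<longleftrightarrow>
     (\<exists>\<C> \<subseteq> sets M. compact_family \<C> \<and> inner_regular_family M \<C>)"


section \<open>First-order formulas in the language of set theory\<close>

datatype fm = Mem nat nat | Eql nat nat | Neg fm | Conj fm fm | All nat fm

primrec sat :: "('a \<Rightarrow> 'a \<Rightarrow> bool) \<Rightarrow> fm \<Rightarrow> (nat \<Rightarrow> 'a) \<Rightarrow> bool" where
  "sat R (Mem i k) s \<longleftrightarrow> R (s i) (s k)"
| "sat R (Eql i k) s \<longleftrightarrow> s i = s k"
| "sat R (Neg \<phi>) s \<longleftrightarrow> \<not> sat R \<phi> s"
| "sat R (Conj \<phi> \<psi>) s \<longleftrightarrow> sat R \<phi> s \<and> sat R \<psi> s"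
| "sat R (All i \<phi>) s \<longleftrightarrow> (\<forall>x. sat R \<phi> (s(i := x)))"

definition elementary_embedding ::
  "('v \<Rightarrow> 'v \<Rightarrow> bool) \<Rightarrow> ('w \<Rightarrow> 'w \<Rightarrow> bool) \<Rightarrow> ('v \<Rightarrow> 'w) \<Rightarrow> bool" where
  "elementary_embedding R S j \<longleftrightarrow> (\<forall>\<phi> s. sat R \<phi> s \<longleftrightarrow> sat S \<phi> (j \<circ> s))"

text \<open>\<open>kpair R p x y\<close>: in the structure with membership \<open>R\<close>, \<open>p\<close> is the Kuratowski pair of \<open>x\<close>
  and \<open>y\<close>.\<close>

definition kpair :: "('a \<Rightarrow> 'a \<Rightarrow> bool) \<Rightarrow> 'a \<Rightarrow> 'a \<Rightarrow> 'a \<Rightarrow> bool" where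
  "kpair R p x y \<longleftrightarrow>
     (\<exists>u v. (\<forall>z. R z p \<longleftrightarrow> z = u \<or> z = v) \<and> (\<forall>z. R z u \<longleftrightarrow> z = x) \<and>
            (\<forall>z. R z v \<longleftrightarrow> z = x \<or> z = y))"


section \<open>The standard universe\<close>

text \<open>HOL has no type that provably carries the superstructure \<open>V\<close> over the natural numbers, so
  \<open>(V, \<in>)\<close> is described up to isomorphism, as a membership relation \<open>mem\<close> on a whole type \<open>'v\<close>.
  As in ZFC, everything is a set and natural numbers are von Neumann numerals; \<open>num n\<close> is the
  element of \<open>V\<close> that is the number \<open>n\<close>.\<close>

context
  fixes mem :: "'v \<Rightarrow> 'v \<Rightarrow> bool" and num :: "nat \<Rightarrow> 'v"
begin

text \<open>The cumulative levels: \<open>V\<^sub>0 = \<nat>\<close> and \<open>V\<^sub>n\<^sub>+\<^sub>1 = V\<^sub>n \<union> \<P>(V\<^sub>n)\<close>.\<close>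

primrec level :: "nat \<Rightarrow> 'v set" where
  "level 0 = range num"
| "level (Suc n) = level n \<union> {x. {y. mem y x} \<subseteq> level n}"

definition standard_universe :: bool where
  "standard_universe \<longleftrightarrow>
     (\<forall>x y. {z. mem z x} = {z. mem z y} \<longrightarrow> x = y) \<and>
     (\<forall>n. {y. mem y (num n)} = num ` {..<n}) \<and>
     (\<forall>n. \<forall>S \<subseteq> level n. \<exists>x. {y. mem y x} = S) \<and>
     (\<Union>n. level n) = UNIV"

text \<open>The element of \<open>V\<close> with extension \<open>S\<close>; meaningful if \<open>S\<close> is contained in some level.\<close>

definition elem_of :: "'v set \<Rightarrow> 'v" where
  "elem_of S = (THE x. {y. mem y x} = S)"

definition nat_rel :: "(nat \<Rightarrow> nat \<Rightarrow> bool) \<Rightarrow> 'v \<Rightarrow> 'v \<Rightarrow> bool" where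
  "nat_rel R x y \<longleftrightarrow> (\<exists>m n. x = num m \<and> y = num n \<and> R m n)"

text \<open>The graph of the cardinality function on finite sets of natural numbers.\<close>

definition card_rel :: "'v \<Rightarrow> 'v \<Rightarrow> bool" where
  "card_rel a y \<longleftrightarrow> (\<exists>S. finite S \<and> {x. mem x a} = num ` S \<and> y = num (card S))"

end


section \<open>Nonstandard universes\<close>

text \<open>\<open>smem\<close> is the membership relation on an elementary extension \<open>'w\<close> of \<open>V\<close>, and
  \<open>star :: 'v \<Rightarrow> 'w\<close> is the elementary embedding.\<close>

context
  fixes mem :: "'v \<Rightarrow> 'v \<Rightarrow> bool" and num :: "nat \<Rightarrow> 'v"
    and smem :: "'w \<Rightarrow> 'w \<Rightarrow> bool" and star :: "'v \<Rightarrow> 'w"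
begin

text \<open>For a standard set \<open>S\<close> contained in some level of \<open>V\<close>, the set of members of its image
  under \<open>star\<close>.\<close>

definition star_set :: "'v set \<Rightarrow> 'w set" where
  "star_set S = {w. smem w (star (elem_of mem S))}"

definition star_rel :: "('v \<Rightarrow> 'v \<Rightarrow> bool) \<Rightarrow> 'w \<Rightarrow> 'w \<Rightarrow> bool" where
  "star_rel R x y \<longleftrightarrow>
     (\<exists>p \<in> star_set {q. \<exists>a b. kpair mem q a b \<and> R a b}. kpair smem p x y)"

definition hypernats :: "'w set" where
  "hypernats = star_set (range num)"

definition infinite_hypernats :: "'w set" where
  "infinite_hypernats = hypernats - range (star \<circ> num)"

text \<open>The truncation at rank \<open>\<omega>\<close>: only the elements of the extended levels of standard finite
  index are kept.\<close>

definition truncation :: "'w set" where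
  "truncation = (\<Union>n. star_set (level mem num n))"

definition internal_sets :: "'w set set" where
  "internal_sets = {{x. smem x a} | a. a \<in> truncation}"

definition saturated :: "'m rel \<Rightarrow> bool" where
  "saturated \<mu> \<longleftrightarrow> (\<forall>\<F> \<subseteq> internal_sets. |\<F>| <o \<mu> \<and> fip \<F> \<longrightarrow> \<Inter>\<F> \<noteq> {})"

text \<open>The last conjunct is \<open>\<omega>\<^sub>1\<close>-saturation.\<close>

definition nonstandard_universe :: bool where
  "nonstandard_universe \<longleftrightarrow>
     standard_universe mem num \<and> elementary_embedding mem smem star \<and>
     infinite_hypernats \<noteq> {} \<and> saturated (cardSuc natLeq)"

text \<open>Internal cardinality, a hypernatural number.\<close>

definition internal_card :: "'w set \<Rightarrow> 'w" where
  "internal_card A =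
     (THE h. \<exists>a. {x. smem x a} = A \<and> star_rel (card_rel mem num) a h)"

text \<open>The standard part of the hyperrational \<open>a / h\<close>: the real \<open>r\<close> such that
  \<open>\<bar>a / h - r\<bar> < \<epsilon>\<close> for all standard \<open>\<epsilon> > 0\<close>. For each \<open>r\<close> and \<open>\<epsilon>\<close>, this inequality is the image
  under \<open>star\<close> of a standard relation between natural numbers.\<close>

definition st_ratio :: "'w \<Rightarrow> 'w \<Rightarrow> real" where
  "st_ratio a h = (THE r. \<forall>\<epsilon>>0. star_rel (nat_rel num (\<lambda>m n. \<bar>real m / real n - r\<bar> < \<epsilon>)) a h)"

text \<open>The hyperfinite set \<open>{1, \<dots>, H}\<close>.\<close>

definition hyperfinite_interval :: "'w \<Rightarrow> 'w set" where
  "hyperfinite_interval H = {x. star_rel (nat_rel num (\<lambda>m n. 1 \<le> m \<and> m \<le> n)) x H}"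

definition loeb_space :: "'w \<Rightarrow> 'w measure" where
  "loeb_space H =
     completion (extend_measure (hyperfinite_interval H)
       {A \<in> internal_sets. A \<subseteq> hyperfinite_interval H} (\<lambda>A. A)
       (\<lambda>A. ennreal (st_ratio (internal_card A) H)))"

end

end

theory Submission
  imports Defs "HOL-Library.Nat_Bijection"
begin

text \<open>Internal sets form an inner regular family, and \<open>\<lambda>\<close>-saturation gives common points to
  families of fewer than \<open>\<lambda>\<close> internal sets with the finite intersection property; so it suffices to
  shrink the internal sets a little in such a way that a family of \<open>\<lambda>\<close> shrunk sets never has that
  property. Choose \<open>\<kappa>\<close> many binary digits \<open>i \<in> K\<close>; they send each \<open>x \<in> \<Omega>\<close> to a point of \<open>2\<^sup>K\<close>, and
  \<open>2\<^sup>K\<close> has only \<open>2\<^sup>\<kappa> = \<lambda>\<close> points \<open>p\<^sub>\<beta>\<close>. Since \<open>\<kappa>\<close> is a strong limit of cofinality \<open>\<omega>\<close>, every set of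
  at most \<open>\<kappa>\<close> points of \<open>2\<^sup>K\<close> is covered by countably many clopen sets of small total measure.
  The \<open>\<alpha>\<close>-th set is shrunk by removing the preimage of such a cover of \<open>{p\<^sub>\<beta>. \<beta> \<le> \<alpha>}\<close>. By compactness
  of \<open>2\<^sup>K\<close>, a family of shrunk sets with the finite intersection property has a common point \<open>p\<^sub>\<beta>\<close> in
  \<open>2\<^sup>K\<close>; all its indices are then below \<open>\<beta>\<close>, so it has at most \<open>\<kappa>\<close> members.\<close>

section \<open>Null sets in the Cantor space over a strong limit cardinal\<close>

text \<open>The obstacle: a subfamily may have \<lambda> members, exactly the size at which
  \<lambda>-saturation says nothing. The space \<open>2^K\<close> only serves to bound the size. Its
  common point need not come from any element of \<Omega>, but it forces the subfamily down to
  \<kappa> members; then saturation, applied to the internal sets from which the members are built,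
  yields a point of \<Omega>. Strong limit: on fewer than \<kappa> points of \<open>2^K\<close> the
  coordinates show fewer than \<kappa> patterns, so infinitely many coordinates agree on all of
  them. Cofinality \<omega>: \<kappa> points split into countably many such pieces.
  \<open>2^\<kappa> = \<kappa>^+\<close>: the points of \<open>2^K\<close> have a listing whose
  proper initial segments have at most \<kappa> members. Binary digits are chosen because constancy
  on n places leaves a fraction of order \<open>2^-n\<close> of the numbers up to H, a count that
  transfers. Since measurable sets are approximated by countable intersections of internal sets, the
  indices involve sequences, and \<open>\<lambda>^\<omega> = \<lambda>\<close>.\<close>

lemma card_of_Pow_ctwo: "|Pow A| =o ctwo ^c |A|"
  unfolding cexp_def ctwo_def Field_card_of by (rule card_of_Pow_Func)

lemma strong_limit_Cinfinite: "strong_limit \<kappa> \<Longrightarrow> Cinfinite \<kappa>"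
  by (simp add: strong_limit_def)

text \<open>The definition of \<open>strong_limit\<close> speaks of subsets of
  \<open>Field \<kappa>\<close> only; a set of any other type is first replaced by an equipotent one
  inside the field.\<close>

lemma strong_limit_Pow:
  assumes "strong_limit \<kappa>" "|A| <o \<kappa>"
  shows "|Pow A| <o \<kappa>"
proof -
  have "Card_order \<kappa>" using assms(1) by (simp add: strong_limit_def)
  then obtain B where B: "B \<subseteq> Field \<kappa>" "|A| =o |B|" "|B| <o \<kappa>"
    using internalize_card_of_ordLess[of A \<kappa>] assms(2) by blast
  have "|Pow A| =o ctwo ^c |A|" by (rule card_of_Pow_ctwo)
  also have "ctwo ^c |A| =o ctwo ^c |B|"
    by (rule cexp_cong2[OF B(2) Card_order_ctwo card_of_Card_order])
  also have "ctwo ^c |B| <o \<kappa>" using B assms(1) by (simp add: strong_limit_def)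
  finally show ?thesis .
qed

text \<open>Pigeonhole on traces, with \<open>Y\<close> read as a set of points of
  \<open>2^K\<close>: coordinate \<open>i\<close> shows on \<open>Y\<close> the pattern
  \<open>t i\<close>, there are at most \<open>2^|Y|\<close> patterns, hence fewer than \<kappa>,
  and so few finite fibres cannot fill \<open>K\<close>. No point of \<open>Y\<close> separates two
  coordinates of the same fibre.\<close>

lemma strong_limit_infinite_constant:
  fixes Y :: "'i set set" and \<kappa> :: "'k rel"
  assumes \<kappa>: "strong_limit \<kappa>" and K: "|K| =o \<kappa>" and Y: "|Y| <o \<kappa>"
  shows "\<exists>F \<subseteq> K. infinite F \<and> (\<forall>p\<in>Y. F \<subseteq> p \<or> F \<inter> p = {})"
proof -
  define t where "t i = {p \<in> Y. i \<in> p}" for i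
  have "infinite K"
    using strong_limit_Cinfinite[OF \<kappa>] card_of_ordIso_finite_Field[OF _ ordIso_symmetric[OF K]]
    unfolding cinfinite_def by simp
  have K_eq: "K = (\<Union>S\<in>Pow Y. {i \<in> K. t i = S})" 
  proof (intro equalityI subsetI)
    show "i \<in> (\<Union>S\<in>Pow Y. {i \<in> K. t i = S})" if "i \<in> K" for i
      by (rule UN_I[of "t i"]) (use that in \<open>auto simp: t_def\<close>)
  qed blast
  have "\<exists>S\<in>Pow Y. infinite {i \<in> K. t i = S}"
  proof (rule ccontr)
    assume "\<not> (\<exists>S\<in>Pow Y. infinite {i \<in> K. t i = S})"
    then have fin: "\<And>S. S \<in> Pow Y \<Longrightarrow> finite {i \<in> K. t i = S}" by blast
    show False
    proof (cases "finite (Pow Y)")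
      case True
      then have "finite (\<Union>S\<in>Pow Y. {i \<in> K. t i = S})" using fin by (rule finite_UN_I)
      with \<open>infinite K\<close> K_eq show False by metis
    next
      case False
      have le: "|{i \<in> K. t i = S}| \<le>o |Pow Y|" if "S \<in> Pow Y" for S
        using fin[OF that] False
        by (intro ordLess_imp_ordLeq finite_ordLess_infinite) (simp_all add: Field_card_of card_of_well_order_on)
      have "|\<Union>S\<in>Pow Y. {i \<in> K. t i = S}| \<le>o |Pow Y|"
        by (rule card_of_UNION_ordLeq_infinite[OF False ordLeq_refl[OF card_of_Card_order]])
          (use le in blast)
      then have "|K| \<le>o |Pow Y|" using K_eq by metis
      moreover have "|Pow Y| <o |K|"
        using strong_limit_Pow[OF \<kappa> Y] K ordIso_symmetric ordLess_ordIso_trans by blast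
      ultimately show False using not_ordLess_ordLeq by blast
    qed
  qed
  then obtain S where S: "infinite {i \<in> K. t i = S}" by blast
  have "{i \<in> K. t i = S} \<subseteq> p \<or> {i \<in> K. t i = S} \<inter> p = {}" if "p \<in> Y" for p
    using that by (cases "p \<in> S") (auto simp: t_def)
  with S show ?thesis by (intro exI[of _ "{i \<in> K. t i = S}"]) auto
qed

text \<open>An injection into \<open>Field \<kappa>\<close> lets a countable cofinal set cut
  \<open>Y\<close> along proper initial segments, which are smaller than \<kappa> because \<kappa>
  is a cardinal.\<close>

lemma countable_cofinality_UN:
  assumes cof: "has_cofinality \<kappa> natLeq" and \<kappa>: "Card_order \<kappa>" and Y: "|Y| \<le>o \<kappa>"
  shows "\<exists>Z :: nat \<Rightarrow> _. Y = (\<Union>n. Z n) \<and> (\<forall>n. |Z n| <o \<kappa>)"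
proof -
  obtain A where A: "A \<subseteq> Field \<kappa>" "cofinal A \<kappa>" "|A| =o natLeq"
    using cof unfolding has_cofinality_def by blast
  have "|UNIV :: nat set| =o |A|"
    by (rule ordIso_transitive[OF card_of_nat ordIso_symmetric[OF A(3)]])
  then obtain e where "bij_betw e (UNIV :: nat set) A"
    unfolding card_of_ordIso[symmetric] by (elim exE)
  then have e: "range e = A" by (simp add: bij_betw_def)
  have "|Y| \<le>o |Field \<kappa>|"
    using Y card_of_Field_ordIso[OF \<kappa>] ordIso_symmetric ordLeq_ordIso_trans by blast
  from iffD2[OF card_of_ordLeq this] obtain h
    where h: "inj_on h Y" "h ` Y \<subseteq> Field \<kappa>" by blast
  define Z where "Z n = {p \<in> Y. h p \<in> underS \<kappa> (e n)}" for n
  have "|Z n| <o \<kappa>" for n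
  proof -
    have "inj_on h (Z n)" "h ` Z n \<subseteq> underS \<kappa> (e n)"
      using h(1) by (auto simp: Z_def intro: inj_on_subset)
    then have "|Z n| \<le>o |underS \<kappa> (e n)|" using card_of_ordLeq by blast
    also have "|underS \<kappa> (e n)| <o \<kappa>" using e A(1) by (intro card_of_underS[OF \<kappa>]) auto
    finally show ?thesis .
  qed
  moreover have "Y = (\<Union>n. Z n)"
  proof (intro equalityI subsetI)
    fix p assume p: "p \<in> Y"
    then obtain b where "b \<in> A" "h p \<noteq> b" "(h p, b) \<in> \<kappa>"
      using A(2) h(2) unfolding cofinal_def by blast
    with p e show "p \<in> (\<Union>n. Z n)" by (auto simp: Z_def underS_def)
  qed (auto simp: Z_def)
  ultimately show ?thesis by blast
qed

text \<open>Cut \<open>Y\<close> into countably many pieces of size less than \<open>\<kappa>\<close>: all points of a piece are constant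
  on a common infinite set of coordinates, so \<open>Y\<close> is null in \<open>2\<^sup>K\<close>.\<close>

lemma constant_cover:
  fixes Y :: "'i set set" and m :: "nat \<Rightarrow> nat" and \<kappa> :: "'k rel"
  assumes \<kappa>: "strong_limit \<kappa>" and cof: "has_cofinality \<kappa> natLeq" and K: "|K| =o \<kappa>" and Y: "|Y| \<le>o \<kappa>"
  shows "\<exists>F. (\<forall>n. finite (F n) \<and> F n \<subseteq> K \<and> card (F n) = m n) \<and>
    (\<forall>p\<in>Y. \<exists>n. F n \<subseteq> p \<or> F n \<inter> p = {})"
proof -
  have "Card_order \<kappa>" using \<kappa> by (simp add: strong_limit_def)
  then obtain Z :: "nat \<Rightarrow> 'i set set" where Z: "Y = (\<Union>n. Z n)" "\<And>n. |Z n| <o \<kappa>"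
    using countable_cofinality_UN[OF cof _ Y] by blast
  \<comment> \<open>Shrinking the infinite set of coordinates to a finite one keeps constancy and
    makes the covering set clopen. Its size \<open>m n\<close> is left open, since the application
    needs the measures to be summable.\<close>
  have "\<exists>F. finite F \<and> F \<subseteq> K \<and> card F = m n \<and> (\<forall>p\<in>Z n. F \<subseteq> p \<or> F \<inter> p = {})" for n
  proof -
    obtain I where I: "I \<subseteq> K" "infinite I" "\<forall>p\<in>Z n. I \<subseteq> p \<or> I \<inter> p = {}"
      using strong_limit_infinite_constant[OF \<kappa> K Z(2)[of n]] by blast
    obtain F where F: "finite F" "card F = m n" "F \<subseteq> I"
      using infinite_arbitrarily_large[OF I(2)] by blast
    moreover have "F \<subseteq> K" using F(3) I(1) by blast
    moreover have "F \<subseteq> p \<or> F \<inter> p = {}" if "p \<in> Z n" for p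
      using I(3) F(3) that by blast
    ultimately show ?thesis by blast
  qed
  then obtain F where F: "\<And>n. finite (F n) \<and> F n \<subseteq> K \<and> card (F n) = m n \<and>
      (\<forall>p\<in>Z n. F n \<subseteq> p \<or> F n \<inter> p = {})"
    by metis
  show ?thesis
  proof (intro exI[of _ F] conjI allI ballI)
    show "\<exists>n. F n \<subseteq> p \<or> F n \<inter> p = {}" if "p \<in> Y" for p
      using that F unfolding Z(1) by (meson UN_iff)
  qed (use F in auto)
qed

section \<open>Compact families from saturation\<close>

lemma compact_UNIV_bool_fun: "compact (UNIV :: ('i \<Rightarrow> bool) set)"
proof -
  have "compact (UNIV :: bool set)" by (rule finite_imp_compact) simp
  then have "compact_space (product_topology (\<lambda>i::'i. euclidean :: bool topology) UNIV)"
    unfolding compact_space_product_topology by (simp add: compact_space_def)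
  then show ?thesis by (simp add: euclidean_product_topology compact_space_def)
qed

text \<open>Compactness of the Cantor space: the condition for \<open>j\<close> involves only the
  finitely many coordinates in \<open>F j\<close>, so it defines a closed set
  \<open>T j\<close>.\<close>

lemma exists_nonconstant:
  fixes F :: "'b \<Rightarrow> 'i set"
  assumes fin: "\<And>j. j \<in> J \<Longrightarrow> finite (F j)"
    and ex: "\<And>J'. finite J' \<Longrightarrow> J' \<subseteq> J \<Longrightarrow> \<exists>q. \<forall>j\<in>J'. \<not> (F j \<subseteq> q \<or> F j \<inter> q = {})"
  shows "\<exists>q. \<forall>j\<in>J. \<not> (F j \<subseteq> q \<or> F j \<inter> q = {})"
proof -
  define T where "T j = - ((\<Inter>i\<in>F j. {f :: 'i \<Rightarrow> bool. f i}) \<union> (\<Inter>i\<in>F j. {f. \<not> f i}))" for j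
  have T_iff: "f \<in> T j \<longleftrightarrow> \<not> (F j \<subseteq> {i. f i} \<or> F j \<inter> {i. f i} = {})" for f j
    by (auto simp: T_def)
  have "open ((\<lambda>f :: 'i \<Rightarrow> bool. f i) -` B)" for i B
    by (rule open_vimage[OF open_discrete continuous_on_product_coordinates])
  from this[of _ "{True}"] this[of _ "{False}"]
  have op: "open {f :: 'i \<Rightarrow> bool. f i}" "open {f :: 'i \<Rightarrow> bool. \<not> f i}" for i
    by (simp_all add: vimage_def)
  have "UNIV \<inter> (\<Inter>j\<in>J. T j) \<noteq> {}"
  proof (rule compact_imp_fip_image[OF compact_UNIV_bool_fun])
    show "closed (T j)" if "j \<in> J" for j
      unfolding T_def using fin[OF that] op by (intro closed_Compl open_Un open_INT) auto
    show "UNIV \<inter> (\<Inter>j\<in>J'. T j) \<noteq> {}" if "finite J'" "J' \<subseteq> J" for J'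
    proof -
      obtain q where "\<forall>j\<in>J'. \<not> (F j \<subseteq> q \<or> F j \<inter> q = {})" using ex[OF \<open>finite J'\<close> \<open>J' \<subseteq> J\<close>] by blast
      then have "(\<lambda>i. i \<in> q) \<in> (\<Inter>j\<in>J'. T j)" by (simp add: T_iff)
      then show ?thesis by blast
    qed
  qed
  then obtain f where "\<And>j. j \<in> J \<Longrightarrow> f \<in> T j" by blast
  then show ?thesis by (intro exI[of _ "{i. f i}"]) (simp add: T_iff)
qed

text \<open>The computation is
  \<open>(2^\<kappa>)^\<omega> = 2^(\<kappa> \<omega>) = 2^\<kappa>\<close>. It allows the pairs of
  a sequence of internal sets and an accuracy to be indexed by \<open>lam\<close>.\<close>

lemma card_of_sequences:
  fixes \<kappa> :: "'k rel" and lam :: "'l rel"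
  assumes \<kappa>: "Cinfinite \<kappa>" and lam: "Card_order lam" "lam =o ctwo ^c \<kappa>" and M: "|M| \<le>o lam"
  shows "|{B :: nat \<Rightarrow> 'a. range B \<subseteq> M} \<times> (UNIV :: nat set)| \<le>o lam"
proof -
  have "Cinfinite (ctwo ^c \<kappa>)" using \<kappa> by (intro Cinfinite_cexp) (simp_all add: ordLeq_refl Card_order_ctwo)
  then have inf: "Cinfinite lam" using lam(2) Cinfinite_cong ordIso_symmetric by blast
  have "{B :: nat \<Rightarrow> 'a. range B \<subseteq> M} = Func (Field natLeq) (Field |M| )"
    by (auto simp: Func_def Field_natLeq Field_card_of)
  then have "|{B :: nat \<Rightarrow> 'a. range B \<subseteq> M}| =o |M| ^c natLeq"
    unfolding cexp_def by (simp add: card_of_refl)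
  also have "|M| ^c natLeq \<le>o lam ^c natLeq" by (rule cexp_mono1[OF M natLeq_Card_order])
  also have "lam ^c natLeq =o (ctwo ^c \<kappa>) ^c natLeq" by (rule cexp_cong1[OF lam(2) natLeq_Card_order])
  also have "(ctwo ^c \<kappa>) ^c natLeq =o ctwo ^c (\<kappa> *c natLeq)" by (rule cexp_cprod[OF Card_order_ctwo])
  also have "ctwo ^c (\<kappa> *c natLeq) =o ctwo ^c \<kappa>"
  proof (rule cexp_cong2[OF _ Card_order_ctwo Card_order_cprod])
    show "\<kappa> *c natLeq =o \<kappa>"
      using \<kappa> by (intro cprod_infinite1' Cinfinite_Cnotzero natLeq_Cinfinite natLeq_ordLeq_cinfinite)
  qed
  also have "ctwo ^c \<kappa> =o lam" using lam(2) by (rule ordIso_symmetric)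
  finally have "|{B :: nat \<Rightarrow> 'a. range B \<subseteq> M}| \<le>o lam" .
  moreover have "|UNIV :: nat set| \<le>o lam"
    using natLeq_ordLeq_cinfinite[OF inf] card_of_nat ordIso_ordLeq_trans by blast
  ultimately show ?thesis
    using inf lam(1) by (intro card_of_Times_ordLeq_infinite_Field) (simp_all add: cinfinite_def)
qed

text \<open>The combinatorial core, free of nonstandard analysis. \<open>X i\<close> is the set
  where digit \<open>i\<close> is 1, and \<open>const F\<close> is the preimage of the clopen set of
  points of \<open>2^K\<close> constant on \<open>F\<close>. An index is a pair of a sequence
  \<open>B\<close> and an exponent \<open>k\<close>, so that each tolerance \<open>e\<close> is met
  by some index \<open>(B, k)\<close>.\<close>

lemma (in algebra) exists_dense_compact_family:
  fixes f :: "'a set \<Rightarrow> real" and X :: "'i \<Rightarrow> 'a set" and K :: "'i set"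
    and \<kappa> :: "'k rel" and lam :: "'l rel"
  defines "const F \<equiv> {x \<in> \<Omega>. (\<forall>i\<in>F. x \<in> X i) \<or> (\<forall>i\<in>F. x \<notin> X i)}"
  assumes \<kappa>: "strong_limit \<kappa>" "has_cofinality \<kappa> natLeq"
    and lam: "Card_order lam" "lam =o cardSuc \<kappa>" "lam =o ctwo ^c \<kappa>"
    and K: "|K| =o \<kappa>" and M: "|M| \<le>o lam"
    and sat: "\<And>\<G>. \<G> \<subseteq> M \<Longrightarrow> |\<G>| <o lam \<Longrightarrow> fip \<G> \<Longrightarrow> \<Inter>\<G> \<noteq> {}"
    and const: "\<And>F. finite F \<Longrightarrow> F \<subseteq> K \<Longrightarrow> const F \<in> M \<and> f (const F) \<le> 4 / 2 ^ card F"
  shows "\<exists>\<C>. compact_family \<C> \<and> (\<forall>B e. range B \<subseteq> M \<longrightarrow> 0 < e \<longrightarrow> (\<exists>E. range E \<subseteq> M \<and>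
      (\<forall>n. f (E n) \<le> e * (1 / 2) ^ Suc n) \<and> (\<Inter>n::nat. B n) - (\<Union>n::nat. E n) \<in> \<C>))"
proof -
  have inf: "Cinfinite \<kappa>" using \<kappa>(1) by (rule strong_limit_Cinfinite)
  have le_\<kappa>: "|A| \<le>o \<kappa> \<longleftrightarrow> |A| <o lam" for A :: "'b set"
  proof -
    have "|A| \<le>o \<kappa> \<longleftrightarrow> |A| <o cardSuc \<kappa>"
      using cardSuc_ordLeq_ordLess[of \<kappa> "|A|"] inf card_of_Card_order by blast
    also have "\<dots> \<longleftrightarrow> |A| <o lam"
      using ordLess_ordIso_trans[OF _ lam(2)] ordLess_ordIso_trans[OF _ ordIso_symmetric[OF lam(2)]]
      by (intro iffI)
    finally show ?thesis .
  qed
  have Field_lam: "|Field lam| =o lam" by (rule card_of_Field_ordIso[OF lam(1)])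
  define J where "J = {B :: nat \<Rightarrow> 'a set. range B \<subseteq> M} \<times> (UNIV :: nat set)"
  have "|J| \<le>o |Field lam|"
    using card_of_sequences[OF inf lam(1,3) M] Field_lam ordIso_symmetric ordLeq_ordIso_trans
    unfolding J_def by blast
  from iffD2[OF card_of_ordLeq this] obtain e
    where e: "inj_on e J" "e ` J \<subseteq> Field lam" by blast
  have "|Pow K| =o ctwo ^c |K|" by (rule card_of_Pow_ctwo)
  also have "ctwo ^c |K| =o ctwo ^c \<kappa>" by (rule cexp_cong2[OF K Card_order_ctwo card_of_Card_order])
  also have "ctwo ^c \<kappa> =o lam" using lam(3) by (rule ordIso_symmetric)
  also have "lam =o |Field lam|" using Field_lam by (rule ordIso_symmetric)
  finally have "|Pow K| \<le>o |Field lam|" by (rule ordIso_imp_ordLeq)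
  from iffD2[OF card_of_ordLeq this] obtain g
    where g: "inj_on g (Pow K)" "g ` Pow K \<subseteq> Field lam" by blast
  have underS_le: "|underS lam a| \<le>o \<kappa>" if "a \<in> Field lam" for a
    unfolding le_\<kappa> by (rule card_of_underS[OF lam(1) that])

  \<comment> \<open>Index \<open>j\<close> receives a cover of all points numbered up to and
    including \<open>e j\<close>. With \<open>k = snd j\<close>, the summand 4 cancels the numerator
    of \<open>4 / 2 ^ card F\<close> and leaves \<open>2 ^ -(n + k + 2)\<close>, within the required
    \<open>2 ^ -(n + k + 1)\<close>.\<close>
  have "\<exists>F. (\<forall>n. finite (F n) \<and> F n \<subseteq> K \<and> card (F n) = n + snd j + 4) \<and>
      (\<forall>p\<in>{p \<in> Pow K. (g p, e j) \<in> lam}. \<exists>n. F n \<subseteq> p \<or> F n \<inter> p = {})" if "j \<in> J" for j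
  proof (rule constant_cover[OF \<kappa> K])
    let ?Y = "{p \<in> Pow K. (g p, e j) \<in> lam}" and ?a = "e j"
    have a: "?a \<in> Field lam" using e(2) that by blast
    have "inj_on g ?Y" "g ` ?Y \<subseteq> {?a} \<union> underS lam ?a"
      using g(1) by (auto simp: underS_def intro: inj_on_subset)
    then have "|?Y| \<le>o |{?a} \<union> underS lam ?a|" using iffD1[OF card_of_ordLeq] by blast
    also have "|{?a} \<union> underS lam ?a| \<le>o \<kappa>"
    proof (rule Un_Cinfinite_bound[OF _ underS_le[OF a] inf])
      have "Field \<kappa> \<noteq> {}" using inf unfolding cinfinite_def by auto
      with inf show "|{?a}| \<le>o \<kappa>" by (intro Card_order_singl_ordLeq) auto
    qed
    finally show "|?Y| \<le>o \<kappa>" .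
  qed
  then have "\<forall>j\<in>J. \<exists>F. (\<forall>n. finite (F n) \<and> F n \<subseteq> K \<and> card (F n) = n + snd j + 4) \<and>
      (\<forall>p\<in>{p \<in> Pow K. (g p, e j) \<in> lam}. \<exists>n. F n \<subseteq> p \<or> F n \<inter> p = {})"
    by (rule ballI)
  from bchoice[OF this] obtain F where F':
    "\<forall>j\<in>J. (\<forall>n. finite (F j n) \<and> F j n \<subseteq> K \<and> card (F j n) = n + snd j + 4) \<and>
      (\<forall>p\<in>{p \<in> Pow K. (g p, e j) \<in> lam}. \<exists>n. F j n \<subseteq> p \<or> F j n \<inter> p = {})" ..
  have F: "finite (F j n)" "F j n \<subseteq> K" "card (F j n) = n + snd j + 4" if "j \<in> J" for j n
    using F' that by simp_all
  have F_const: "\<exists>n. F j n \<subseteq> p \<or> F j n \<inter> p = {}" if "j \<in> J" "p \<subseteq> K" "(g p, e j) \<in> lam" for j p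
    using F' that by simp
  define C where "C j = (\<Inter>n. fst j n) - (\<Union>n. const (F j n))" for j :: "(nat \<Rightarrow> 'a set) \<times> nat"
  have J_M: "fst j n \<in> M" if "j \<in> J" for j n
    using that unfolding J_def by (cases j) auto
  have const_M: "const (F j n) \<in> M" if "j \<in> J" for j n
    using const[OF F(1,2)[OF that]] by (rule conjunct1)

  have "compact_family (C ` J)"
    unfolding compact_family_def
  proof (intro allI impI)
    fix \<D> assume \<D>: "\<D> \<subseteq> C ` J" "fip \<D>"
    define J' where "J' = {j \<in> J. C j \<in> \<D>}"
    have J': "J' \<subseteq> J" "\<D> = C ` J'" using \<D>(1) by (auto simp: J'_def)
    have C_nonempty: "(\<Inter>j\<in>I. C j) \<noteq> {}" if "finite I" "I \<subseteq> J'" for I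
      using \<D>(2) that J'(2) unfolding fip_def by (meson finite_imageI image_mono)
    have C_\<Omega>: "C j \<subseteq> \<Omega>" if "j \<in> J" for j
      using sets_into_space[OF J_M[OF that, of 0]] by (auto simp: C_def)
    \<comment> \<open>At this stage \<open>J'\<close> may be as large as \<open>lam\<close>, so
      saturation is out of reach. Finite intersections suffice: the digits of a point in finitely
      many \<open>C j\<close> avoid finitely many of the clopen sets, and compactness yields one
      \<open>q\<close> avoiding all of them.\<close>
    have "\<exists>q. \<forall>z\<in>J' \<times> (UNIV :: nat set). \<not> (F (fst z) (snd z) \<subseteq> q \<or> F (fst z) (snd z) \<inter> q = {})"
    proof (rule exists_nonconstant)
      show "finite (F (fst z) (snd z))" if "z \<in> J' \<times> UNIV" for z
        using F(1) J'(1) that by auto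
      fix I :: "(((nat \<Rightarrow> 'a set) \<times> nat) \<times> nat) set" assume I: "finite I" "I \<subseteq> J' \<times> UNIV"
      then obtain x where x: "x \<in> (\<Inter>j\<in>fst ` I. C j)" using C_nonempty[of "fst ` I"] by fastforce
      show "\<exists>q. \<forall>z\<in>I. \<not> (F (fst z) (snd z) \<subseteq> q \<or> F (fst z) (snd z) \<inter> q = {})"
      proof (intro exI[of _ "{i. x \<in> X i}"] ballI)
        fix z assume z: "z \<in> I"
        then have "fst z \<in> J'" using I(2) by (metis mem_Times_iff subsetD)
        then have "fst z \<in> J" using J'(1) by (rule subsetD[rotated])
        moreover have "x \<in> C (fst z)" using x z by blast
        ultimately have "x \<in> \<Omega>" "x \<notin> const (F (fst z) (snd z))"
          using C_\<Omega>[of "fst z"] unfolding C_def by blast+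
        then show "\<not> (F (fst z) (snd z) \<subseteq> {i. x \<in> X i} \<or> F (fst z) (snd z) \<inter> {i. x \<in> X i} = {})"
          by (auto simp: const_def)
      qed
    qed
    then obtain q where
      "\<forall>z\<in>J' \<times> (UNIV :: nat set). \<not> (F (fst z) (snd z) \<subseteq> q \<or> F (fst z) (snd z) \<inter> q = {})" ..
    then have q: "\<not> (F j n \<subseteq> q \<or> F j n \<inter> q = {})" if "j \<in> J'" for j n
      using that by (auto dest!: bspec[of _ _ "(j, n)"])
    \<comment> \<open>The cover of an index at or beyond the number of \<open>q \<inter> K\<close>
      catches this point, but \<open>q\<close> escapes the covers of all indices in
      \<open>J'\<close>. By linearity these indices lie strictly below.\<close>
    have less: "e j \<in> underS lam (g (q \<inter> K))" if "j \<in> J'" for j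
    proof -
      have j: "j \<in> J" using that J'(1) by blast
      have "\<not> (F j n \<subseteq> q \<inter> K \<or> F j n \<inter> (q \<inter> K) = {})" for n
        using q[OF that, of n] F(2)[OF j, of n] by blast
      then have "(g (q \<inter> K), e j) \<notin> lam" using F_const[OF j, of "q \<inter> K"] by blast
      moreover have "g (q \<inter> K) \<in> Field lam" "e j \<in> Field lam" using g(2) e(2) j by auto
      moreover have "Linear_order lam"
        using lam(1) unfolding card_order_on_def well_order_on_def by blast
      ultimately show ?thesis
        unfolding underS_def using Linear_order_in_diff_Id[of lam "g (q \<inter> K)" "e j"] by blast
    qed
    have "inj_on e J'" using e(1) J'(1) by (rule inj_on_subset)
    moreover have "e ` J' \<subseteq> underS lam (g (q \<inter> K))" using less by blast
    ultimately have "|J'| \<le>o |underS lam (g (q \<inter> K))|" using card_of_ordLeq by blast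
    also have "|underS lam (g (q \<inter> K))| \<le>o \<kappa>" using g(2) by (intro underS_le) auto
    finally have "|J'| \<le>o \<kappa>" .
    moreover have "|UNIV :: nat set| \<le>o \<kappa>"
      using natLeq_ordLeq_cinfinite[OF inf] card_of_nat ordIso_ordLeq_trans by blast
    ultimately have J'_le: "|J' \<times> (UNIV :: nat set)| \<le>o \<kappa>"
      using inf by (intro card_of_Times_ordLeq_infinite_Field) (simp_all add: cinfinite_def)
    \<comment> \<open>The sets \<open>C j\<close> themselves need not belong to \<open>M\<close>.
      Each is the intersection of countably many members of \<open>M\<close> collected here; with at
      most \<kappa> indices left, these are few enough for \<open>sat\<close>.\<close>
    define \<G> where "\<G> = (\<lambda>(j, n). fst j n) ` (J' \<times> (UNIV :: nat set)) \<union>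
      (\<lambda>(j, n). \<Omega> - const (F j n)) ` (J' \<times> (UNIV :: nat set))"
    have "|\<G>| \<le>o \<kappa>"
      unfolding \<G>_def
      by (intro Un_Cinfinite_bound ordLeq_transitive[OF card_of_image J'_le] inf)
    then have "|\<G>| <o lam" by (simp add: le_\<kappa>)
    moreover have "\<G> \<subseteq> M" using J_M const_M J'(1) by (auto simp: \<G>_def intro!: compl_sets)
    moreover have "fip \<G>"
      unfolding fip_def
    proof (intro allI impI)
      fix G assume G: "G \<subseteq> \<G>" "finite G"
      have "\<exists>j\<in>J'. C j \<subseteq> A" if "A \<in> G" for A
      proof -
        have "A \<in> \<G>" using G(1) that by blast
        then obtain j n where j: "j \<in> J'" "A = fst j n \<or> A = \<Omega> - const (F j n)"
          unfolding \<G>_def by fast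
        then have "j \<in> J" using J'(1) by blast
        from j(2) C_\<Omega>[OF this] have "C j \<subseteq> A" unfolding C_def by blast
        with j(1) show ?thesis by blast
      qed
      then obtain j where j: "\<And>A. A \<in> G \<Longrightarrow> j A \<in> J'" "\<And>A. A \<in> G \<Longrightarrow> C (j A) \<subseteq> A" by metis
      have "(\<Inter>i\<in>j ` G. C i) \<noteq> {}" using j(1) G(2) by (intro C_nonempty) auto
      moreover have "(\<Inter>i\<in>j ` G. C i) \<subseteq> \<Inter>G" using j(2) by fast
      ultimately show "\<Inter>G \<noteq> {}" by blast
    qed
    ultimately obtain x where x: "x \<in> \<Inter>\<G>" using sat by blast
    have "x \<in> C j" if "j \<in> J'" for j
    proof -
      have "x \<in> fst j n" "x \<in> \<Omega> - const (F j n)" for n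
        using x that unfolding \<G>_def by blast+
      then show ?thesis by (auto simp: C_def)
    qed
    then show "\<Inter>\<D> \<noteq> {}" unfolding J'(2) by blast
  qed
  moreover have "\<exists>E. range E \<subseteq> M \<and> (\<forall>n. f (E n) \<le> r * (1 / 2) ^ Suc n) \<and>
      (\<Inter>n::nat. B n) - (\<Union>n::nat. E n) \<in> C ` J" if "range B \<subseteq> M" "0 < r" for B r
  proof -
    obtain k where k: "(1 / 2) ^ k < r" using real_arch_pow_inv[OF \<open>0 < r\<close>, of "1 / 2"] by auto
    have j: "(B, k) \<in> J" using that(1) by (simp add: J_def)
    have "f (const (F (B, k) n)) \<le> r * (1 / 2) ^ Suc n" for n
    proof -
      have "f (const (F (B, k) n)) \<le> 4 / 2 ^ (n + k + 4)"
        using const[OF F(1)[OF j, of n] F(2)[OF j, of n]] F(3)[OF j, of n] by simp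
      also have "\<dots> \<le> (1 / 2) ^ k * (1 / 2) ^ Suc n" by (simp add: power_add field_simps)
      also have "\<dots> \<le> r * (1 / 2) ^ Suc n" using k by (intro mult_right_mono) auto
      finally show ?thesis .
    qed
    moreover have "range (\<lambda>n. const (F (B, k) n)) \<subseteq> M" using const_M[OF j] by blast
    moreover have "(\<Inter>n. B n) - (\<Union>n. const (F (B, k) n)) \<in> C ` J"
      using j by (intro image_eqI[of _ _ "(B, k)"]) (auto simp: C_def)
    ultimately show ?thesis by blast
  qed
  ultimately show ?thesis by blast
qed

section \<open>Inner regularity of the measure extending a content\<close>

lemma Int_range_Un_Int_range:
  fixes B C :: "nat \<Rightarrow> 'a set"
  shows "(\<Inter>n. B n) \<union> (\<Inter>n. C n) = (\<Inter>n. case prod_decode n of (i, j) \<Rightarrow> B i \<union> C j)"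
proof (intro equalityI subsetI)
  fix x assume "x \<in> (\<Inter>n. B n) \<union> (\<Inter>n. C n)"
  then show "x \<in> (\<Inter>n. case prod_decode n of (i, j) \<Rightarrow> B i \<union> C j)" by (auto split: prod.split)
next
  fix x assume x: "x \<in> (\<Inter>n. case prod_decode n of (i, j) \<Rightarrow> B i \<union> C j)"
  have "x \<in> B i \<union> C j" for i j
    using INT_D[OF x, of "prod_encode (i, j)"] by simp
  then show "x \<in> (\<Inter>n. B n) \<union> (\<Inter>n. C n)" by auto
qed

text \<open>By distributivity the union of two countable intersections is the intersection over all
  pairs of indices. This keeps the inner approximations of the sandwich argument in the required
  form under finite unions.\<close>

lemma (in algebra) finite_UN_INT:
  fixes K :: "nat \<Rightarrow> nat \<Rightarrow> 'a set"
  assumes "\<And>i n. K i n \<in> M"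
  shows "\<exists>B. range B \<subseteq> M \<and> (\<Union>i<N. \<Inter>n. K i n) = (\<Inter>n::nat. B n)"
proof (induction N)
  case 0
  show ?case by (rule exI[of _ "\<lambda>_. {}"]) simp
next
  case (Suc N)
  then obtain B :: "nat \<Rightarrow> 'a set" where B: "range B \<subseteq> M" "(\<Union>i<N. \<Inter>n. K i n) = (\<Inter>n. B n)"
    by blast
  have "(\<Union>i<Suc N. \<Inter>n. K i n) = (\<Inter>n. B n) \<union> (\<Inter>n. K N n)"
    unfolding lessThan_Suc UN_insert B(2) by (rule Un_commute)
  also have "\<dots> = (\<Inter>n. case prod_decode n of (i, j) \<Rightarrow> B i \<union> K N j)"
    by (rule Int_range_Un_Int_range)
  finally show ?case
    using range_subsetD[OF B(1)] assms
    by (intro exI[of _ "\<lambda>n. case prod_decode n of (i, j) \<Rightarrow> B i \<union> K N j"])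
      (auto split: prod.split intro!: Un)
qed

text \<open>Induction over the generated \<sigma>-algebra. Inner and outer approximation are carried
  together because complementation exchanges them.\<close>

lemma (in finite_measure) sandwich_algebra:
  assumes "algebra (space M) \<A>" and sets: "sets M = sigma_sets (space M) \<A>"
    and "A \<in> sets M" "0 < e"
  shows "\<exists>B G. range B \<subseteq> \<A> \<and> range G \<subseteq> \<A> \<and> (\<Inter>n::nat. B n) \<subseteq> A \<and> A \<subseteq> (\<Union>n::nat. G n) \<and>
    measure M ((\<Union>n. G n) - (\<Inter>n. B n)) < e"
proof -
  interpret alg: algebra "space M" \<A> by fact
  have A_sets: "\<A> \<subseteq> sets M" using sets by auto
  from assms(3) have "A \<in> sigma_sets (space M) \<A>" by (simp add: sets)
  then show ?thesis
    using \<open>0 < e\<close>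
  proof (induction A arbitrary: e rule: sigma_sets.induct)
    case (Basic a)
    then show ?case by (intro exI[of _ "\<lambda>_. a"]) auto
  next
    case Empty
    then show ?case by (intro exI[of _ "\<lambda>_. {}"]) auto
  next
    case (Compl a)
    obtain B G where BG: "range B \<subseteq> \<A>" "range G \<subseteq> \<A>" "(\<Inter>n::nat. B n) \<subseteq> a" "a \<subseteq> (\<Union>n::nat. G n)"
      "measure M ((\<Union>n. G n) - (\<Inter>n. B n)) < e"
      using Compl.IH[OF Compl.prems] by blast
    have "(\<Union>n. G n) \<subseteq> space M" using BG(2) alg.sets_into_space by blast
    then have "(\<Union>n. space M - B n) - (\<Inter>n. space M - G n) = (\<Union>n. G n) - (\<Inter>n. B n)" by auto
    moreover have "range (\<lambda>n. space M - B n) \<subseteq> \<A>" "range (\<lambda>n. space M - G n) \<subseteq> \<A>"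
      using BG(1,2) alg.compl_sets by auto
    moreover have "(\<Inter>n. space M - G n) \<subseteq> space M - a" "space M - a \<subseteq> (\<Union>n. space M - B n)"
      using BG(3,4) by auto
    ultimately show ?case
      using BG(5) by (intro exI[of _ "\<lambda>n. space M - G n"] exI[of _ "\<lambda>n. space M - B n"]) simp
  next
    case (Union a)
    \<comment> \<open>The errors of the pieces add up to \<open>e / 2\<close>; the other half is
      reserved for truncating the union of the inner sets.\<close>
    have "\<exists>B G. range B \<subseteq> \<A> \<and> range G \<subseteq> \<A> \<and> (\<Inter>n::nat. B n) \<subseteq> a i \<and> a i \<subseteq> (\<Union>n::nat. G n) \<and>
      measure M ((\<Union>n. G n) - (\<Inter>n. B n)) < e / 2 * (1 / 2) ^ Suc i" for i
      using Union.IH[of "e / 2 * (1 / 2) ^ Suc i" i] Union.prems by simp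
    then obtain B G where BG: "\<And>i. range (B i) \<subseteq> \<A>" "\<And>i. range (G i) \<subseteq> \<A>"
      "\<And>i. (\<Inter>n::nat. B i n) \<subseteq> a i" "\<And>i. a i \<subseteq> (\<Union>n::nat. G i n)"
      "\<And>i. measure M ((\<Union>n. G i n) - (\<Inter>n. B i n)) < e / 2 * (1 / 2) ^ Suc i"
      by metis
    define K where "K i = (\<Inter>n. B i n)" for i
    define U where "U i = (\<Union>n. G i n)" for i
    have K_sets: "K i \<in> sets M" and U_sets: "U i \<in> sets M" for i
      using BG(1,2)[of i] A_sets by (auto simp: K_def U_def)
    \<comment> \<open>An infinite union of countable intersections need not be a countable
      intersection of members of the algebra, so the inner sets are united only up to some
      \<open>N\<close>; continuity from below makes the loss small.\<close>
    have "(\<lambda>N. measure M (\<Union>i<N. K i)) \<longlonglongrightarrow> measure M (\<Union>N. \<Union>i<N. K i)"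
      by (rule finite_Lim_measure_incseq) (use K_sets in \<open>force simp: incseq_def\<close>)+
    moreover have "(\<Union>N. \<Union>i<N. K i) = (\<Union>i. K i)" by auto
    ultimately have "\<forall>\<^sub>F N in sequentially. measure M (\<Union>i. K i) - e / 2 < measure M (\<Union>i<N. K i)"
      using Union.prems by (intro order_tendstoD) auto
    then obtain N where N: "measure M (\<Union>i. K i) - e / 2 < measure M (\<Union>i<N. K i)"
      by (auto simp: eventually_sequentially)
    have "measure M ((\<Union>i. K i) - (\<Union>i<N. K i)) = measure M (\<Union>i. K i) - measure M (\<Union>i<N. K i)"
      by (rule finite_measure_Diff) (use K_sets in auto)
    with N have small: "measure M ((\<Union>i. K i) - (\<Union>i<N. K i)) < e / 2" by simp
    have sums: "(\<lambda>i. e / 2 * (1 / 2) ^ Suc i) sums (e / 2)"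
      using sums_mult[OF power_half_series, of "e / 2"] by simp
    have summable: "summable (\<lambda>i. measure M (U i - K i))"
      by (rule summable_comparison_test'[OF sums_summable[OF sums], of 0])
        (use BG(5) in \<open>auto simp: U_def K_def intro: less_imp_le\<close>)
    have "measure M (\<Union>i. U i - K i) \<le> (\<Sum>i. measure M (U i - K i))"
      by (rule finite_measure_subadditive_countably[OF _ summable]) (use K_sets U_sets in auto)
    also have "\<dots> \<le> (\<Sum>i. e / 2 * (1 / 2) ^ Suc i)"
      by (rule suminf_le[OF _ summable sums_summable[OF sums]])
        (use BG(5) in \<open>auto simp: U_def K_def intro: less_imp_le\<close>)
    also have "\<dots> = e / 2" using sums by (rule sums_unique[symmetric])
    finally have diff: "measure M (\<Union>i. U i - K i) \<le> e / 2" .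
    have "measure M ((\<Union>i. U i) - (\<Union>i<N. K i)) \<le>
        measure M ((\<Union>i. U i - K i) \<union> ((\<Union>i. K i) - (\<Union>i<N. K i)))"
      by (rule finite_measure_mono) (use K_sets U_sets in auto)
    also have "\<dots> \<le> measure M (\<Union>i. U i - K i) + measure M ((\<Union>i. K i) - (\<Union>i<N. K i))"
      by (rule measure_Un_le) (use K_sets U_sets in auto)
    also have "\<dots> < e" using diff small by simp
    finally have lt: "measure M ((\<Union>i. U i) - (\<Union>i<N. K i)) < e" .
    have "B i n \<in> \<A>" for i n using BG(1) by blast
    then have "\<exists>B'. range B' \<subseteq> \<A> \<and> (\<Union>i<N. K i) = (\<Inter>n::nat. B' n)"
      unfolding K_def by (rule alg.finite_UN_INT)
    then obtain B' where B': "range B' \<subseteq> \<A> \<and> (\<Union>i<N. K i) = (\<Inter>n::nat. B' n)" ..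
    define G' where "G' n = G (fst (prod_decode n)) (snd (prod_decode n))" for n
    have "(\<Union>i. U i) = (\<Union>n. G' n)"
    proof (intro equalityI subsetI)
      fix x assume "x \<in> (\<Union>i. U i)"
      then obtain i j where "x \<in> G i j" by (auto simp: U_def)
      then have "x \<in> G' (prod_encode (i, j))" by (simp add: G'_def)
      then show "x \<in> (\<Union>n. G' n)" by blast
    qed (auto simp: G'_def U_def)
    moreover have "range G' \<subseteq> \<A>" using BG(2) by (auto simp: G'_def)
    moreover have "(\<Union>i<N. K i) \<subseteq> (\<Union>i. a i)" "(\<Union>i. a i) \<subseteq> (\<Union>i. U i)"
      unfolding K_def U_def using BG(3,4) by (intro UN_mono; simp)+
    ultimately show ?case
      using B' lt by (intro exI[of _ B'] exI[of _ G'] conjI) simp_all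
  qed
qed

lemma compact_familyD: "compact_family \<C> \<Longrightarrow> \<D> \<subseteq> \<C> \<Longrightarrow> compact_family \<D>"
  unfolding compact_family_def by blast

lemma fip_decseq:
  fixes A :: "nat \<Rightarrow> 'a set"
  assumes "decseq A" "\<And>i. A i \<noteq> {}"
  shows "fip (range A)"
  unfolding fip_def
proof (intro allI impI)
  fix F assume "F \<subseteq> range A" "finite F"
  then obtain J where J: "finite J" "F = A ` J" by (meson finite_subset_image)
  \<comment> \<open>Inserting 0 keeps \<open>Max\<close> meaningful when \<open>J\<close> is
    empty.\<close>
  have "A (Max (insert 0 J)) \<subseteq> A i" if "i \<in> J" for i
    using assms(1) Max_ge[of "insert 0 J" i] J(1) that unfolding decseq_def by blast
  then have "A (Max (insert 0 J)) \<subseteq> \<Inter>F"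
    using J(2) by blast
  then show "\<Inter>F \<noteq> {}" using assms(2) by blast
qed

text \<open>Caratheodory extension. Continuity at the empty set holds for the strongest reason: by
  countable compactness, a decreasing sequence with empty intersection is empty from some index
  on.\<close>

lemma (in algebra) content_extends:
  fixes f :: "'a set \<Rightarrow> real"
  assumes nonneg: "\<And>A. A \<in> M \<Longrightarrow> 0 \<le> f A"
    and add: "\<And>A B. A \<in> M \<Longrightarrow> B \<in> M \<Longrightarrow> A \<inter> B = {} \<Longrightarrow> f (A \<union> B) = f A + f B"
    and compact: "\<And>\<G>. \<G> \<subseteq> M \<Longrightarrow> countable \<G> \<Longrightarrow> fip \<G> \<Longrightarrow> \<Inter>\<G> \<noteq> {}"
    and "A \<in> M"
  shows "emeasure (extend_measure \<Omega> M (\<lambda>A. A) (\<lambda>A. ennreal (f A))) A = ennreal (f A)"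
proof -
  have f0: "f {} = 0" using add[of "{}" "{}"] by simp
  have "\<exists>\<mu> :: 'a set \<Rightarrow> ennreal. (\<forall>s \<in> M. \<mu> s = ennreal (f s)) \<and> measure_space \<Omega> (sigma_sets \<Omega> M) \<mu>"
  proof (rule caratheodory_empty_continuous)
    show "positive M (\<lambda>A. ennreal (f A))" by (simp add: positive_def f0)
    show "Measure_Space.additive M (\<lambda>A. ennreal (f A))"
      unfolding Measure_Space.additive_def using add nonneg by (simp add: ennreal_plus)
  next
    fix A :: "nat \<Rightarrow> 'a set" assume A: "range A \<subseteq> M" "decseq A" "(\<Inter>i. A i) = {}"
    have "\<exists>i. A i = {}"
    proof (rule ccontr)
      assume "\<not> (\<exists>i. A i = {})"
      then have "fip (range A)" using fip_decseq[OF A(2)] by blast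
      then show False using compact[OF A(1)] A(3) by auto
    qed
    then obtain i where i: "A i = {}" by blast
    have "\<forall>\<^sub>F n in sequentially. ennreal (f (A n)) = 0"
      using eventually_ge_at_top[of i]
    proof eventually_elim
      case (elim n)
      then have "A n = {}" using i A(2) by (auto simp: decseq_def)
      then show ?case by (simp add: f0)
    qed
    then show "(\<lambda>i. ennreal (f (A i))) \<longlonglongrightarrow> 0" by (rule tendsto_eventually)
  qed simp
  then obtain \<mu> :: "'a set \<Rightarrow> ennreal" where \<mu>: "\<And>s. s \<in> M \<Longrightarrow> \<mu> s = ennreal (f s)"
    "measure_space \<Omega> (sigma_sets \<Omega> M) \<mu>" by blast
  have sub: "(\<lambda>A. A) ` M \<subseteq> Pow \<Omega>" using space_closed by simp
  show ?thesis
  proof (rule emeasure_extend_measure[OF refl])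
    show "positive (sets (extend_measure \<Omega> M (\<lambda>A. A) (\<lambda>A. ennreal (f A)))) \<mu>"
      "countably_additive (sets (extend_measure \<Omega> M (\<lambda>A. A) (\<lambda>A. ennreal (f A)))) \<mu>"
      using \<mu>(2) unfolding sets_extend_measure[OF sub] by (simp_all add: measure_space_def)
  qed (use \<mu>(1) sub \<open>A \<in> M\<close> in auto)
qed

text \<open>Half of the tolerance pays for the sandwich around the measurable set, the other half
  for the removed sets \<open>E n\<close>, whose bounds sum to \<open>e / 2\<close>.\<close>

lemma (in algebra) compact_measure_spaceI:
  fixes f :: "'a set \<Rightarrow> real"
  assumes nonneg: "\<And>A. A \<in> M \<Longrightarrow> 0 \<le> f A"
    and add: "\<And>A B. A \<in> M \<Longrightarrow> B \<in> M \<Longrightarrow> A \<inter> B = {} \<Longrightarrow> f (A \<union> B) = f A + f B"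
    and countably_compact: "\<And>\<G>. \<G> \<subseteq> M \<Longrightarrow> countable \<G> \<Longrightarrow> fip \<G> \<Longrightarrow> \<Inter>\<G> \<noteq> {}"
    and compact: "compact_family \<C>"
    and dense: "\<And>B e. range B \<subseteq> M \<Longrightarrow> 0 < e \<Longrightarrow> \<exists>E. range E \<subseteq> M \<and>
      (\<forall>n. f (E n) \<le> e * (1 / 2) ^ Suc n) \<and> (\<Inter>n::nat. B n) - (\<Union>n::nat. E n) \<in> \<C>"
  shows "compact_measure_space (completion (extend_measure \<Omega> M (\<lambda>A. A) (\<lambda>A. ennreal (f A))))"
proof -
  define L where "L = extend_measure \<Omega> M (\<lambda>A. A) (\<lambda>A. ennreal (f A))"
  have sub: "(\<lambda>A. A) ` M \<subseteq> Pow \<Omega>" using space_closed by simp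
  have space: "space L = \<Omega>" unfolding L_def by (rule space_extend_measure[OF sub])
  have sets: "sets L = sigma_sets \<Omega> M" unfolding L_def by (simp add: sets_extend_measure[OF sub])
  have M_sets: "M \<subseteq> sets L" by (auto simp: sets)
  have L: "emeasure L A = ennreal (f A)" if "A \<in> M" for A
    unfolding L_def by (rule content_extends[OF nonneg add countably_compact that])
  interpret L: finite_measure L
    by standard (simp add: space L)
  have measure_L: "measure L A = f A" if "A \<in> M" for A
    using L[OF that] nonneg[OF that] by (simp add: measure_def)
  have approx: "\<exists>C \<in> \<C> \<inter> sets L. C \<subseteq> A \<and> emeasure L A \<le> emeasure L C + ennreal e"
    if A: "A \<in> sets L" and "0 < e" for A e
  proof -
    obtain B G where BG: "range B \<subseteq> M" "range G \<subseteq> M" "(\<Inter>n::nat. B n) \<subseteq> A" "A \<subseteq> (\<Union>n::nat. G n)"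
      "measure L ((\<Union>n. G n) - (\<Inter>n. B n)) < e / 2"
      using L.sandwich_algebra[of M A "e / 2"] A \<open>0 < e\<close> algebra_axioms by (auto simp: space sets)
    obtain E where E: "range E \<subseteq> M" "\<And>n. f (E n) \<le> e / 2 * (1 / 2) ^ Suc n"
      "(\<Inter>n. B n) - (\<Union>n::nat. E n) \<in> \<C>"
      using dense[OF BG(1), of "e / 2"] \<open>0 < e\<close> by auto
    have B_sets: "(\<Inter>n. B n) \<in> sets L" and E_sets: "(\<Union>n. E n) \<in> sets L" and G_sets: "(\<Union>n. G n) \<in> sets L"
      and E_range: "range E \<subseteq> sets L"
      using subset_trans[OF BG(1) M_sets] subset_trans[OF BG(2) M_sets] subset_trans[OF E(1) M_sets]
      by (auto intro!: sets.countable_INT' sets.countable_UN)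
    have sums: "(\<lambda>i. e / 2 * (1 / 2) ^ Suc i) sums (e / 2)"
      using sums_mult[OF power_half_series, of "e / 2"] by simp
    have E_le: "measure L (E n) \<le> e / 2 * (1 / 2) ^ Suc n" for n
      using E(2)[of n] measure_L[of "E n"] E(1) by (simp add: range_subsetD)
    have summable: "summable (\<lambda>n. measure L (E n))"
      by (rule summable_comparison_test'[OF sums_summable[OF sums], of 0]) (use E_le in auto)
    have "measure L (\<Union>n. E n) \<le> (\<Sum>n. measure L (E n))"
      by (rule L.finite_measure_subadditive_countably[OF E_range summable])
    also have "\<dots> \<le> (\<Sum>n. e / 2 * (1 / 2) ^ Suc n)"
      by (rule suminf_le[OF E_le summable sums_summable[OF sums]])
    also have "\<dots> = e / 2" using sums by (rule sums_unique[symmetric])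
    finally have E_small: "measure L (\<Union>n. E n) \<le> e / 2" .
    let ?C = "(\<Inter>n. B n) - (\<Union>n. E n)"
    have "measure L A \<le> measure L (?C \<union> ((\<Union>n. E n) \<union> ((\<Union>n. G n) - (\<Inter>n. B n))))"
      by (rule L.finite_measure_mono) (use BG(4) B_sets E_sets G_sets in auto)
    also have "\<dots> \<le> measure L ?C + measure L ((\<Union>n. E n) \<union> ((\<Union>n. G n) - (\<Inter>n. B n)))"
      by (rule measure_Un_le) (use B_sets E_sets G_sets in auto)
    also have "measure L ((\<Union>n. E n) \<union> ((\<Union>n. G n) - (\<Inter>n. B n))) \<le>
        measure L (\<Union>n. E n) + measure L ((\<Union>n. G n) - (\<Inter>n. B n))"
      by (rule measure_Un_le) (use B_sets E_sets G_sets in auto)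
    finally have "measure L A \<le> measure L ?C + e" using E_small BG(5) by simp
    then have "emeasure L A \<le> emeasure L ?C + ennreal e"
      using \<open>0 < e\<close> by (simp add: L.emeasure_eq_measure flip: ennreal_plus)
    then show ?thesis
      using E(3) B_sets E_sets BG(3) by (intro bexI[of _ ?C]) auto
  qed
  have "inner_regular_family (completion L) (\<C> \<inter> sets L)"
    unfolding inner_regular_family_def
  proof
    fix A assume A: "A \<in> sets (completion L)"
    let ?S = "SUP C \<in> {C \<in> \<C> \<inter> sets L. C \<subseteq> A}. emeasure (completion L) C"
    show "emeasure (completion L) A = ?S"
    proof (rule antisym)
      show "?S \<le> emeasure (completion L) A"
        by (rule SUP_least) (use A in \<open>blast intro: emeasure_mono\<close>)
      show "emeasure (completion L) A \<le> ?S"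
      proof (rule ennreal_le_epsilon)
        fix e :: real assume "0 < e"
        \<comment> \<open>In the completion it is enough to approximate the main part: it is
          measurable before completing and differs from \<open>A\<close> by a null set.\<close>
        have main: "main_part L A \<in> sets L" "main_part L A \<subseteq> A"
          using A main_part_null_part_Un[OF A] by blast+
        obtain C where C: "C \<in> \<C> \<inter> sets L" "C \<subseteq> main_part L A"
          "emeasure L (main_part L A) \<le> emeasure L C + ennreal e"
          using approx[OF main(1) \<open>0 < e\<close>] by blast
        have "emeasure L C = emeasure (completion L) C" using C(1) by simp
        also have "\<dots> \<le> ?S" by (rule SUP_upper) (use C main in auto)
        finally show "emeasure (completion L) A \<le> ?S + ennreal e"
          using C(3) A by (metis add_right_mono emeasure_completion order_trans)
      qed
    qed
  qed
  moreover have "\<C> \<inter> sets L \<subseteq> sets (completion L)" by auto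
  moreover have "compact_family (\<C> \<inter> sets L)" using compact by (rule compact_familyD) simp
  ultimately show ?thesis unfolding compact_measure_space_def L_def by blast
qed

section \<open>Transfer\<close>

text \<open>Bound variables are renamed together with the free ones; the injectivity assumed in
  \<open>sat_rename_fm\<close> rules out capture.\<close>

primrec rename_fm :: "(nat \<Rightarrow> nat) \<Rightarrow> fm \<Rightarrow> fm" where
  "rename_fm f (Mem i k) = Mem (f i) (f k)"
| "rename_fm f (Eql i k) = Eql (f i) (f k)"
| "rename_fm f (Neg \<phi>) = Neg (rename_fm f \<phi>)"
| "rename_fm f (Conj \<phi> \<psi>) = Conj (rename_fm f \<phi>) (rename_fm f \<psi>)"
| "rename_fm f (All i \<phi>) = All (f i) (rename_fm f \<phi>)"

lemma sat_rename_fm: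
  assumes "inj f"
  shows "sat R (rename_fm f \<phi>) s \<longleftrightarrow> sat R \<phi> (s \<circ> f)"
proof (induction \<phi> arbitrary: s)
  case (All i \<phi>)
  have "s(f i := x) \<circ> f = (s \<circ> f)(i := x)" for x
    using assms by (auto simp: fun_eq_iff inj_eq)
  with All show ?case by (auto simp: o_def)
qed (auto)

text \<open>Valuations are split: even variables carry the arguments of a formula, odd variables its
  standard parameters.\<close>

definition merge :: "(nat \<Rightarrow> 'a) \<Rightarrow> (nat \<Rightarrow> 'a) \<Rightarrow> nat \<Rightarrow> 'a" where
  "merge c s i = (if even i then s (i div 2) else c (i div 2))"

lemma comp_merge: "g \<circ> merge c s = merge (g \<circ> c) (g \<circ> s)"
  by (auto simp: merge_def fun_eq_iff)

text \<open>When two formulas are joined, their parameter lists \<open>c\<close> and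
  \<open>d\<close> are interleaved to \<open>merge c d\<close>. Entry \<open>j\<close> of
  \<open>c\<close> then sits at variable \<open>4 * j + 3\<close>, entry \<open>j\<close> of
  \<open>d\<close> at \<open>4 * j + 1\<close>; argument variables stay in place.\<close>

definition left_var :: "nat \<Rightarrow> nat" where
  "left_var i = (if even i then i else 4 * (i div 2) + 3)"

definition right_var :: "nat \<Rightarrow> nat" where
  "right_var i = (if even i then i else 4 * (i div 2) + 1)"

lemma inj_var: "inj left_var" "inj right_var"
  unfolding left_var_def right_var_def
  by (auto intro!: injI split: if_splits elim!: evenE oddE; presburger)+

lemma merge_merge_var [simp]:
  "merge (merge c d) s (left_var i) = merge c s i"
  "merge (merge c d) s (right_var i) = merge d s i"
proof -
  have "even i \<or> (\<exists>j. i = 2 * j + 1)" by presburger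
  moreover have "(4 * j + 3) div 2 = 2 * j + 1" "(4 * j + 1) div 2 = 2 * j" for j :: nat
    by presburger+
  ultimately show "merge (merge c d) s (left_var i) = merge c s i"
    "merge (merge c d) s (right_var i) = merge d s i"
    by (auto simp: merge_def left_var_def right_var_def)
qed

lemma merge_var:
  "merge (merge c d) s \<circ> left_var = merge c s"
  "merge (merge c d) s \<circ> right_var = merge d s"
  by (simp_all add: fun_eq_iff)

locale universe_pair =
  fixes mem :: "'v \<Rightarrow> 'v \<Rightarrow> bool" and num :: "nat \<Rightarrow> 'v"
    and smem :: "'w \<Rightarrow> 'w \<Rightarrow> bool" and star :: "'v \<Rightarrow> 'w"
  assumes universe: "standard_universe mem num"
    and elementary: "elementary_embedding mem smem star"
begin

text \<open>Arguments are de Bruijn indexed, so that the closure rules below apply to \<open>\<lambda>\<close>-terms by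
  higher-order pattern unification.\<close>

definition transfers :: "((nat \<Rightarrow> 'v) \<Rightarrow> bool) \<Rightarrow> ((nat \<Rightarrow> 'w) \<Rightarrow> bool) \<Rightarrow> bool" where
  "transfers P Q \<longleftrightarrow> (\<exists>\<phi> c. (\<forall>s. P s \<longleftrightarrow> sat mem \<phi> (merge c s)) \<and>
     (\<forall>t. Q t \<longleftrightarrow> sat smem \<phi> (merge (star \<circ> c) t)))"

text \<open>The terms of the language in both structures at once: a variable, or a name for an
  element of V. There are no function symbols.\<close>

definition term_pair :: "((nat \<Rightarrow> 'v) \<Rightarrow> 'v) \<Rightarrow> ((nat \<Rightarrow> 'w) \<Rightarrow> 'w) \<Rightarrow> bool" where
  "term_pair e f \<longleftrightarrow> (\<exists>i. e = (\<lambda>s. s i) \<and> f = (\<lambda>t. t i)) \<or> (\<exists>a. e = (\<lambda>_. a) \<and> f = (\<lambda>_. star a))"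

lemma transferD:
  assumes "transfers (\<lambda>_. A) (\<lambda>_. B)" A
  shows B
proof -
  obtain \<phi> c where 1: "\<And>s. A \<longleftrightarrow> sat mem \<phi> (merge c s)"
    and 2: "\<And>t. B \<longleftrightarrow> sat smem \<phi> (merge (star \<circ> c) t)"
    using assms(1) by (auto simp: transfers_def)
  \<comment> \<open>A closed statement does not depend on the argument valuation, so an arbitrary
    one may be used.\<close>
  have "A \<longleftrightarrow> sat smem \<phi> (star \<circ> merge c undefined)"
    using 1 elementary by (simp add: elementary_embedding_def)
  with 2 assms(2) show ?thesis by (simp add: comp_merge)
qed

lemma transfers_not: "transfers P Q \<Longrightarrow> transfers (\<lambda>s. \<not> P s) (\<lambda>t. \<not> Q t)"
  unfolding transfers_def by (metis sat.simps(3))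

lemma transfers_conj:
  assumes "transfers P Q" "transfers P' Q'"
  shows "transfers (\<lambda>s. P s \<and> P' s) (\<lambda>t. Q t \<and> Q' t)"
proof -
  obtain \<phi> c where 1: "\<And>s. P s \<longleftrightarrow> sat mem \<phi> (merge c s)"
    "\<And>t. Q t \<longleftrightarrow> sat smem \<phi> (merge (star \<circ> c) t)"
    using assms(1) by (auto simp: transfers_def)
  obtain \<psi> d where 2: "\<And>s. P' s \<longleftrightarrow> sat mem \<psi> (merge d s)"
    "\<And>t. Q' t \<longleftrightarrow> sat smem \<psi> (merge (star \<circ> d) t)"
    using assms(2) by (auto simp: transfers_def)
  show ?thesis
    unfolding transfers_def
    by (rule exI[of _ "Conj (rename_fm left_var \<phi>) (rename_fm right_var \<psi>)"], rule exI[of _ "merge c d"])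
      (simp add: sat_rename_fm inj_var merge_var 1 2 comp_merge)
qed

lemma transfers_all:
  assumes "transfers (\<lambda>s. P (s 0) (\<lambda>n. s (Suc n))) (\<lambda>t. Q (t 0) (\<lambda>n. t (Suc n)))"
  shows "transfers (\<lambda>s. \<forall>x. P x s) (\<lambda>t. \<forall>x. Q x t)"
proof -
  obtain \<phi> c where 1: "\<And>s. P (s 0) (\<lambda>n. s (Suc n)) \<longleftrightarrow> sat mem \<phi> (merge c s)"
    "\<And>t. Q (t 0) (\<lambda>n. t (Suc n)) \<longleftrightarrow> sat smem \<phi> (merge (star \<circ> c) t)"
    using assms by (auto simp: transfers_def)
  have 2: "P x s \<longleftrightarrow> sat mem \<phi> (merge c (case_nat x s))" for x s
    using 1(1)[of "case_nat x s"] by simp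
  have 3: "Q x s \<longleftrightarrow> sat smem \<phi> (merge (star \<circ> c) (case_nat x s))" for x s
    using 1(2)[of "case_nat x s"] by simp
  \<comment> \<open>Argument 0 moves to variable 1 and is bound there; the other arguments move down
    one place. The parameters move up one place to free variable 1, so the new parameter list starts
    with a dummy entry, which the quantifier overwrites.\<close>
  define f :: "nat \<Rightarrow> nat" where "f i = (if i = 0 then 1 else if even i then i - 2 else i + 2)" for i
  have inj: "inj f"
    unfolding f_def by (auto intro!: injI split: if_splits elim!: evenE oddE; presburger)
  have f: "(merge (case_nat u c') s)(1 := x) \<circ> f = merge c' (case_nat x s)"
    for c' s :: "nat \<Rightarrow> 'b" and u x
    by (auto simp: merge_def f_def fun_eq_iff elim!: oddE evenE split: nat.split)
  have g: "star \<circ> case_nat u c = case_nat (star u) (star \<circ> c)" for u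
    by (auto simp: fun_eq_iff split: nat.split)
  show ?thesis
    unfolding transfers_def
    by (rule exI[of _ "All 1 (rename_fm f \<phi>)"], rule exI[of _ "case_nat undefined c"])
      (simp add: sat_rename_fm inj 2 3 f[simplified] g)
qed

lemma transfers_imp: "transfers P Q \<Longrightarrow> transfers P' Q' \<Longrightarrow> transfers (\<lambda>s. P s \<longrightarrow> P' s) (\<lambda>t. Q t \<longrightarrow> Q' t)"
  using transfers_not[OF transfers_conj[OF _ transfers_not], of P Q P' Q'] by simp

lemma transfers_disj: "transfers P Q \<Longrightarrow> transfers P' Q' \<Longrightarrow> transfers (\<lambda>s. P s \<or> P' s) (\<lambda>t. Q t \<or> Q' t)"
  using transfers_imp[OF transfers_not, of P Q P' Q'] by (simp add: disj_imp)

lemma transfers_iff: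
  assumes "transfers P Q" "transfers P' Q'"
  shows "transfers (\<lambda>s. P s \<longleftrightarrow> P' s) (\<lambda>t. Q t \<longleftrightarrow> Q' t)"
  using transfers_conj[OF transfers_imp[OF assms] transfers_imp[OF assms(2,1)]]
  by (simp add: iff_conv_conj_imp)

lemma transfers_ex:
  assumes "transfers (\<lambda>s. P (s 0) (\<lambda>n. s (Suc n))) (\<lambda>t. Q (t 0) (\<lambda>n. t (Suc n)))"
  shows "transfers (\<lambda>s. \<exists>x. P x s) (\<lambda>t. \<exists>x. Q x t)"
proof -
  have "transfers (\<lambda>s. \<not> (\<forall>x. \<not> P x s)) (\<lambda>t. \<not> (\<forall>x. \<not> Q x t))"
    by (intro transfers_not transfers_all assms)
  then show ?thesis by simp
qed

lemma term_pair_var: "term_pair (\<lambda>s. s i) (\<lambda>t. t i)"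
  and term_pair_const: "term_pair (\<lambda>_. a) (\<lambda>_. star a)"
  by (auto simp: term_pair_def)

lemma term_pair_shift: "term_pair e f \<Longrightarrow> term_pair (\<lambda>s. e (\<lambda>n. s (Suc n))) (\<lambda>t. f (\<lambda>n. t (Suc n)))"
  by (auto simp: term_pair_def)

lemma term_pair_merge:
  assumes "term_pair e f"
  shows "\<exists>c i. (\<forall>s. e s = merge c s i) \<and> (\<forall>t. f t = merge (star \<circ> c) t i)"
  using assms unfolding term_pair_def
proof (elim disjE exE conjE)
  fix i assume "e = (\<lambda>s. s i)" "f = (\<lambda>t. t i)"
  then show ?thesis by (intro exI[of _ undefined] exI[of _ "2 * i"]) (auto simp: merge_def)
next
  fix a assume "e = (\<lambda>_. a)" "f = (\<lambda>_. star a)"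
  then show ?thesis by (intro exI[of _ "\<lambda>_. a"] exI[of _ 1]) (auto simp: merge_def)
qed

lemma transfers_atom:
  assumes "term_pair e f" "term_pair e' f'"
  shows "transfers (\<lambda>s. mem (e s) (e' s)) (\<lambda>t. smem (f t) (f' t))"
    and "transfers (\<lambda>s. e s = e' s) (\<lambda>t. f t = f' t)"
proof -
  obtain i c where e: "\<And>s. e s = merge c s i" "\<And>t. f t = merge (star \<circ> c) t i"
    using term_pair_merge[OF assms(1)] by auto
  obtain k d where e': "\<And>s. e' s = merge d s k" "\<And>t. f' t = merge (star \<circ> d) t k"
    using term_pair_merge[OF assms(2)] by auto
  show "transfers (\<lambda>s. mem (e s) (e' s)) (\<lambda>t. smem (f t) (f' t))"
    unfolding transfers_def e e'
    by (rule exI[of _ "Mem (left_var i) (right_var k)"], rule exI[of _ "merge c d"])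
      (simp add: comp_merge)
  show "transfers (\<lambda>s. e s = e' s) (\<lambda>t. f t = f' t)"
    unfolding transfers_def e e'
    by (rule exI[of _ "Eql (left_var i) (right_var k)"], rule exI[of _ "merge c d"])
      (simp add: comp_merge)
qed

lemmas transfers_base = transfers_not transfers_conj transfers_disj transfers_imp transfers_iff
  transfers_all transfers_ex transfers_atom term_pair_var term_pair_const

lemma transfers_kpair:
  assumes "term_pair p p'" "term_pair e f" "term_pair e' f'"
  shows "transfers (\<lambda>s. kpair mem (p s) (e s) (e' s)) (\<lambda>t. kpair smem (p' t) (f t) (f' t))"
  unfolding kpair_def
  by (intro transfers_base assms assms[THEN term_pair_shift] assms[THEN term_pair_shift, THEN term_pair_shift]
     assms[THEN term_pair_shift, THEN term_pair_shift, THEN term_pair_shift])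

end

section \<open>Sets, pairs and graphs of relations in the standard universe\<close>

context universe_pair
begin

lemma mem_ext: "(\<And>z. mem z x \<longleftrightarrow> mem z y) \<Longrightarrow> x = y"
  using universe unfolding standard_universe_def by auto

lemma mem_num: "mem y (num n) \<longleftrightarrow> y \<in> num ` {..<n}"
  using universe unfolding standard_universe_def by blast

lemma exists_set: "S \<subseteq> level mem num n \<Longrightarrow> \<exists>x. \<forall>y. mem y x \<longleftrightarrow> y \<in> S"
  using universe unfolding standard_universe_def by blast

lemma in_some_level: "\<exists>n. x \<in> level mem num n"
proof -
  have "x \<in> (\<Union>n. level mem num n)" using universe unfolding standard_universe_def by simp
  then show ?thesis by simp
qed

lemma num_not_mem_self: "\<not> mem (num n) (num n)"
proof (induction n rule: less_induct)
  case (less n)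
  show ?case
  proof
    assume "mem (num n) (num n)"
    then obtain i where "i < n" "num n = num i" by (auto simp: mem_num)
    with less \<open>mem (num n) (num n)\<close> show False by metis
  qed
qed

lemma num_eq_iff [simp]: "num m = num n \<longleftrightarrow> m = n"
proof -
  have "num m \<noteq> num n" if "m < n" for m n
    using that num_not_mem_self[of m] mem_num[of "num m" n] by auto
  then show ?thesis by (metis nat_neq_iff)
qed

lemma mem_num_num [simp]: "mem (num m) (num n) \<longleftrightarrow> m < n"
  by (auto simp: mem_num)

lemma level_transitive: "x \<in> level mem num n \<Longrightarrow> mem y x \<Longrightarrow> y \<in> level mem num n"
proof (induction n)
  case 0
  then show ?case by (auto simp: mem_num)
next
  case (Suc n)
  then show ?case by auto
qed

lemma exists_subset: "\<exists>c. \<forall>x. mem x c \<longleftrightarrow> mem x a \<and> P x"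
proof -
  obtain n where "a \<in> level mem num n" using in_some_level by blast
  then have "{x. mem x a \<and> P x} \<subseteq> level mem num n" using level_transitive by blast
  from exists_set[OF this] show ?thesis by simp
qed

lemma mem_elem_of:
  assumes "S \<subseteq> level mem num n"
  shows "mem y (elem_of mem S) \<longleftrightarrow> y \<in> S"
proof -
  obtain x where x: "\<And>y. mem y x \<longleftrightarrow> y \<in> S" using exists_set[OF assms] by blast
  have "{y. mem y (elem_of mem S)} = S"
    unfolding elem_of_def
  proof (rule theI)
    show "{y. mem y x} = S" using x by auto
    show "z = x" if "{y. mem y z} = S" for z using that x by (intro mem_ext) auto
  qed
  then show ?thesis by auto
qed

lemma exists_kpair:
  assumes "a \<in> level mem num k" "b \<in> level mem num k"
  shows "\<exists>p. kpair mem p a b"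
proof -
  obtain u where u: "\<And>z. mem z u \<longleftrightarrow> z = a"
    using exists_set[of "{a}" k] assms by auto
  obtain v where v: "\<And>z. mem z v \<longleftrightarrow> z = a \<or> z = b"
    using exists_set[of "{a, b}" k] assms by auto
  have "{u, v} \<subseteq> level mem num (Suc k)" using u v assms by auto
  then obtain p where "\<And>z. mem z p \<longleftrightarrow> z = u \<or> z = v"
    using exists_set[OF \<open>{u, v} \<subseteq> level mem num (Suc k)\<close>] by auto
  with u v show ?thesis unfolding kpair_def by blast
qed

lemma kpair_in_level:
  assumes "kpair mem p a b" "a \<in> level mem num k" "b \<in> level mem num k"
  shows "p \<in> level mem num (k + 2)"
proof -
  obtain u v where uv: "\<And>z. mem z p \<longleftrightarrow> z = u \<or> z = v" "\<And>z. mem z u \<longleftrightarrow> z = a"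
    "\<And>z. mem z v \<longleftrightarrow> z = a \<or> z = b"
    using assms(1) unfolding kpair_def by blast
  have "u \<in> level mem num (Suc k)" "v \<in> level mem num (Suc k)" using uv assms by auto
  with uv show ?thesis by auto
qed

lemma kpair_inject:
  assumes "kpair mem p a b" "kpair mem p a' b'"
  shows "a = a'" "b = b'"
proof -
  obtain u v where uv: "\<And>z. mem z p \<longleftrightarrow> z = u \<or> z = v" "\<And>z. mem z u \<longleftrightarrow> z = a"
    "\<And>z. mem z v \<longleftrightarrow> z = a \<or> z = b"
    using assms(1) unfolding kpair_def by blast
  obtain u' v' where uv': "\<And>z. mem z p \<longleftrightarrow> z = u' \<or> z = v'" "\<And>z. mem z u' \<longleftrightarrow> z = a'"
    "\<And>z. mem z v' \<longleftrightarrow> z = a' \<or> z = b'"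
    using assms(2) unfolding kpair_def by blast
  show "a = a'" "b = b'" using uv uv' by metis+
qed

text \<open>Pairs of elements of one level lie two levels higher, so the graph of a bounded relation
  is itself an element of V.\<close>

lemma mem_graph:
  assumes "\<And>a b. R a b \<Longrightarrow> a \<in> level mem num k \<and> b \<in> level mem num k"
  shows "R a b \<longleftrightarrow> (\<exists>p. mem p (elem_of mem {q. \<exists>a b. kpair mem q a b \<and> R a b}) \<and> kpair mem p a b)"
proof -
  have sub: "{q. \<exists>a b. kpair mem q a b \<and> R a b} \<subseteq> level mem num (k + 2)"
    using kpair_in_level assms by blast
  have "(\<exists>p. (\<exists>a b. kpair mem p a b \<and> R a b) \<and> kpair mem p a b) \<longleftrightarrow> R a b"
    using exists_kpair assms kpair_inject by metis
  then show ?thesis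
    using mem_elem_of[OF sub] by simp
qed

abbreviation srel :: "('v \<Rightarrow> 'v \<Rightarrow> bool) \<Rightarrow> 'w \<Rightarrow> 'w \<Rightarrow> bool" where
  "srel \<equiv> star_rel mem smem star"

text \<open>The graph of \<open>R\<close> serves as a parameter. Hence any bounded relation, however
  it is defined in HOL, acts as an atomic formula, and powers, digits and real ratios never have to
  be expressed in the language of set theory.\<close>

lemma transfers_rel:
  assumes R: "\<And>a b. R a b \<Longrightarrow> a \<in> level mem num k \<and> b \<in> level mem num k"
    and t: "term_pair e f" "term_pair e' f'"
  shows "transfers (\<lambda>s. R (e s) (e' s)) (\<lambda>t. srel R (f t) (f' t))"
proof -
  define G where "G = elem_of mem {q. \<exists>a b. kpair mem q a b \<and> R a b}"
  have "transfers (\<lambda>s. \<exists>p. mem p G \<and> kpair mem p (e s) (e' s))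
     (\<lambda>t. \<exists>p. smem p (star G) \<and> kpair smem p (f t) (f' t))"
    by (intro transfers_ex transfers_conj transfers_atom transfers_kpair term_pair_var term_pair_const t[THEN term_pair_shift])
  then show ?thesis
    by (simp add: star_rel_def star_set_def G_def[symmetric] Bex_def mem_graph[where R = R, OF R, folded G_def, symmetric])
qed

text \<open>The code is the number whose binary digits 1 stand at the places in \<open>S\<close>.
  Its transfer codes internal sets by hypernaturals and thereby counts them.\<close>

definition code_rel :: "'v \<Rightarrow> 'v \<Rightarrow> bool" where
  "code_rel a y \<longleftrightarrow> (\<exists>S. finite S \<and> {x. mem x a} = num ` S \<and> y = num (set_encode S))"

lemma transfers_nat_rel: "term_pair e f \<Longrightarrow> term_pair e' f' \<Longrightarrow>
    transfers (\<lambda>s. nat_rel num R (e s) (e' s)) (\<lambda>t. srel (nat_rel num R) (f t) (f' t))"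
  by (rule transfers_rel[where k = 0]) (auto simp: nat_rel_def)

lemma transfers_card_rel: "term_pair e f \<Longrightarrow> term_pair e' f' \<Longrightarrow>
    transfers (\<lambda>s. card_rel mem num (e s) (e' s)) (\<lambda>t. srel (card_rel mem num) (f t) (f' t))"
  by (rule transfers_rel[where k = 1]) (force simp: card_rel_def)+

lemma transfers_code_rel: "term_pair e f \<Longrightarrow> term_pair e' f' \<Longrightarrow>
    transfers (\<lambda>s. code_rel (e s) (e' s)) (\<lambda>t. srel code_rel (f t) (f' t))"
  by (rule transfers_rel[where k = 1]) (force simp: code_rel_def)+

lemmas transfers_intros = transfers_nat_rel transfers_card_rel transfers_code_rel transfers_base

end

section \<open>Hyperfinite sets of natural numbers\<close>

lemma card_supersets_le:
  assumes "finite B" "F \<subseteq> B"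
  shows "card {S. F \<subseteq> S \<and> S \<subseteq> B} * 2 ^ card F \<le> 2 ^ card B"
    and "card {S. S \<inter> F = {} \<and> S \<subseteq> B} * 2 ^ card F \<le> 2 ^ card B"
proof -
  have fin: "finite F" "finite (B - F)" using assms finite_subset by auto
  have card: "card (B - F) + card F = card B"
    using assms fin by (simp add: card_Diff_subset card_mono)
  have "{S. F \<subseteq> S \<and> S \<subseteq> B} \<subseteq> (\<union>) F ` Pow (B - F)"
  proof
    fix S assume "S \<in> {S. F \<subseteq> S \<and> S \<subseteq> B}"
    then have "S = F \<union> (S - F)" "S - F \<in> Pow (B - F)" by auto
    then show "S \<in> (\<union>) F ` Pow (B - F)" by blast
  qed
  then have "card {S. F \<subseteq> S \<and> S \<subseteq> B} \<le> card (Pow (B - F))"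
    using fin by (meson surj_card_le finite_Pow_iff)
  then show "card {S. F \<subseteq> S \<and> S \<subseteq> B} * 2 ^ card F \<le> 2 ^ card B"
    using fin by (simp add: card_Pow power_add flip: card)
  have "{S. S \<inter> F = {} \<and> S \<subseteq> B} = Pow (B - F)" by auto
  then show "card {S. S \<inter> F = {} \<and> S \<subseteq> B} * 2 ^ card F \<le> 2 ^ card B"
    using fin by (simp add: card_Pow power_add flip: card)
qed

lemma two_power_le_of_set_decode: "i \<in> set_decode x \<Longrightarrow> 2 ^ i \<le> x"
  by (rule ccontr) (auto simp: set_decode_def)

text \<open>With \<open>2 ^ k \<le> h < 2 ^ Suc k\<close>, binary expansion embeds the numbers up to
  \<open>h\<close> into the subsets of \<open>{..<Suc k}\<close>. Fixing the digits in
  \<open>F\<close> divides \<open>2 ^ Suc k\<close> by \<open>2 ^ card F\<close>, and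
  \<open>2 ^ Suc k \<le> 2 * h\<close> is the origin of the factor 2. The bound on \<open>F\<close>
  places it inside \<open>{..<Suc k}\<close>; at higher places all digits vanish anyway.\<close>

lemma card_bits_le:
  fixes h :: nat
  assumes F: "finite F" "\<And>i. i \<in> F \<Longrightarrow> 2 ^ i \<le> h" and h: "1 \<le> h"
  shows "card {m. m \<le> h \<and> F \<subseteq> set_decode m} * 2 ^ card F \<le> 2 * h"
    and "card {m. m \<le> h \<and> set_decode m \<inter> F = {}} * 2 ^ card F \<le> 2 * h"
proof -
  obtain k where k: "2 ^ k \<le> h" "h < 2 ^ Suc k"
    using ex_power_ivl1[of 2 h] h by auto
  have less: "i < Suc k" if "2 ^ i \<le> m" "m \<le> h" for i m :: nat
  proof (rule power_less_imp_less_exp)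
    show "(2 :: nat) ^ i < 2 ^ Suc k" using that k by linarith
  qed simp
  then have FB: "F \<subseteq> {..<Suc k}" using F by blast
  have dec: "set_decode m \<subseteq> {..<Suc k}" if "m \<le> h" for m
    using less[OF two_power_le_of_set_decode that] by blast
  have inj: "inj_on set_decode X" for X
    by (metis inj_onI set_decode_inverse)
  have fin: "finite {S. S \<subseteq> {..<Suc k}}"
    by (metis Pow_def finite_Pow_iff finite_lessThan)
  have "card {m. m \<le> h \<and> F \<subseteq> set_decode m} \<le> card {S. F \<subseteq> S \<and> S \<subseteq> {..<Suc k}}"
    by (rule card_inj_on_le[OF inj]) (use dec in \<open>auto intro: finite_subset[OF _ fin]\<close>)
  moreover have "card {m. m \<le> h \<and> set_decode m \<inter> F = {}}
      \<le> card {S. S \<inter> F = {} \<and> S \<subseteq> {..<Suc k}}"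
    by (rule card_inj_on_le[OF inj]) (use dec in \<open>auto intro: finite_subset[OF _ fin]\<close>)
  moreover have "2 ^ card {..<Suc k} \<le> 2 * h" using k by simp
  ultimately show "card {m. m \<le> h \<and> F \<subseteq> set_decode m} * 2 ^ card F \<le> 2 * h"
    "card {m. m \<le> h \<and> set_decode m \<inter> F = {}} * 2 ^ card F \<le> 2 * h"
    using card_supersets_le[OF _ FB] by (meson finite_lessThan le_trans mult_le_mono1)+
qed

context universe_pair
begin

abbreviation NN :: 'v where "NN \<equiv> elem_of mem (range num)"
abbreviation in_interval :: "'v \<Rightarrow> 'v \<Rightarrow> bool" where "in_interval \<equiv> nat_rel num (\<lambda>m n. 1 \<le> m \<and> m \<le> n)"
abbreviation bit_rel :: "'v \<Rightarrow> 'v \<Rightarrow> bool" where "bit_rel \<equiv> nat_rel num (\<lambda>i m. i \<in> set_decode m)"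
abbreviation pow_le :: "'v \<Rightarrow> 'v \<Rightarrow> bool" where "pow_le \<equiv> nat_rel num (\<lambda>i n. 2 ^ i \<le> n)"
abbreviation ratio_near :: "real \<Rightarrow> real \<Rightarrow> 'v \<Rightarrow> 'v \<Rightarrow> bool" where
  "ratio_near r \<epsilon> \<equiv> nat_rel num (\<lambda>m n. \<bar>real m / real n - r\<bar> < \<epsilon>)"
text \<open>Multiplied out, so that division by zero does not interfere. The reals \<open>q\<close>
  for which this holds form the cut that defines the standard part.\<close>

abbreviation ratio_ge :: "real \<Rightarrow> 'v \<Rightarrow> 'v \<Rightarrow> bool" where
  "ratio_ge q \<equiv> nat_rel num (\<lambda>m n. q * real n \<le> real m)"

lemma mem_NN [simp]: "mem y NN \<longleftrightarrow> y \<in> range num"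
  by (rule mem_elem_of[where n = 0]) simp

lemma nat_rel_num [simp]: "nat_rel num R (num m) (num n) \<longleftrightarrow> R m n"
  by (auto simp: nat_rel_def)

lemma nat_relD: "nat_rel num R x y \<Longrightarrow> x \<in> range num \<and> y \<in> range num"
  by (auto simp: nat_rel_def)

lemma card_rel_iff:
  assumes "finite S" "{x. mem x a} = num ` S"
  shows "card_rel mem num a y \<longleftrightarrow> y = num (card S)"
proof -
  have "S' = S" if "{x. mem x a} = num ` S'" for S'
  proof -
    have "num ` S' = num ` S" using that assms(2) by auto
    then show ?thesis by (simp add: inj_image_eq_iff inj_def)
  qed
  then show ?thesis
    unfolding card_rel_def using assms by (auto intro!: exI[of _ S])
qed

lemma code_rel_iff:
  assumes "finite S" "{x. mem x a} = num ` S"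
  shows "code_rel a y \<longleftrightarrow> y = num (set_encode S)"
proof -
  have "S' = S" if "{x. mem x a} = num ` S'" for S'
  proof -
    have "num ` S' = num ` S" using that assms(2) by auto
    then show ?thesis by (simp add: inj_image_eq_iff inj_def)
  qed
  then show ?thesis
    unfolding code_rel_def using assms by (auto intro!: exI[of _ S])
qed

lemma card_relE:
  assumes "card_rel mem num a y"
  obtains S where "finite S" "\<And>x. mem x a \<longleftrightarrow> x \<in> num ` S" "y = num (card S)"
  using assms unfolding card_rel_def by blast

lemma finite_extension:
  assumes "\<And>x. mem x a \<Longrightarrow> in_interval x h"
  shows "\<exists>S. finite S \<and> {x. mem x a} = num ` S"
proof (cases "\<exists>n. h = num n")
  case True
  then obtain n where n: "h = num n" by blast
  show ?thesis
  proof (intro exI conjI)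
    show "finite {m. mem (num m) a}"
      by (rule finite_subset[of _ "{..n}"]) (use assms n in force)+
    show "{x. mem x a} = num ` {m. mem (num m) a}"
      using assms nat_relD by blast
  qed
next
  case False
  then have "{x. mem x a} = num ` {}" using assms nat_relD by blast
  then show ?thesis by blast
qed

text \<open>The pattern of most \<open>star_\<close> lemmas: the closed statement is verified in V,
  \<open>transfers_intros\<close> builds its formula, and \<open>transferD\<close> carries it
  over.\<close>

lemma star_ext: "(\<And>z. smem z x \<longleftrightarrow> smem z y) \<Longrightarrow> x = y"
proof -
  have "\<forall>x y. (\<forall>z. smem z x \<longleftrightarrow> smem z y) \<longrightarrow> x = y"
    by (rule transferD[where A = "\<forall>x y. (\<forall>z. mem z x \<longleftrightarrow> mem z y) \<longrightarrow> x = y"], intro transfers_intros)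
      (auto intro: mem_ext)
  then show "(\<And>z. smem z x \<longleftrightarrow> smem z y) \<Longrightarrow> x = y" by blast
qed

text \<open>Level 1 contains all sets of natural numbers; by transfer, every set of hypernaturals in
  the extension lies in the truncation and so is internal.\<close>

lemma star_subset_NN:
  assumes "\<And>y. smem y a \<Longrightarrow> smem y (star NN)"
  shows "smem a (star (elem_of mem (level mem num 1)))"
proof -
  have "\<forall>a. (\<forall>y. smem y a \<longrightarrow> smem y (star NN)) \<longrightarrow> smem a (star (elem_of mem (level mem num 1)))"
    by (rule transferD[where A = "\<forall>a. (\<forall>y. mem y a \<longrightarrow> mem y NN) \<longrightarrow> mem a (elem_of mem (level mem num 1))"],
      intro transfers_intros) (use mem_elem_of[of "level mem num 1" 1] in auto)
  with assms show ?thesis by blast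
qed

lemma star_diff: "\<exists>c. \<forall>x. smem x c \<longleftrightarrow> smem x a \<and> \<not> smem x b"
proof -
  have "\<forall>a b. \<exists>c. \<forall>x. smem x c \<longleftrightarrow> smem x a \<and> \<not> smem x b"
    by (rule transferD[where A = "\<forall>a b. \<exists>c. \<forall>x. mem x c \<longleftrightarrow> mem x a \<and> \<not> mem x b"],
      intro transfers_intros) (auto intro: exists_subset)
  then show ?thesis by blast
qed

lemma star_interval: "\<exists>c. \<forall>x. smem x c \<longleftrightarrow> srel in_interval x h"
proof -
  have "\<exists>c. \<forall>x. mem x c \<longleftrightarrow> in_interval x h" for h
    using exists_subset[of NN "\<lambda>x. in_interval x h"] by (auto dest: nat_relD)
  then have "\<forall>h. \<exists>c. \<forall>x. smem x c \<longleftrightarrow> srel in_interval x h"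
    by - (rule transferD[where A = "\<forall>h. \<exists>c. \<forall>x. mem x c \<longleftrightarrow> in_interval x h"],
      intro transfers_intros, blast)
  then show ?thesis by blast
qed

lemma star_pow_interval: "\<exists>c. \<forall>x. smem x c \<longleftrightarrow> srel pow_le x h"
proof -
  have "\<exists>c. \<forall>x. mem x c \<longleftrightarrow> pow_le x h" for h
    using exists_subset[of NN "\<lambda>x. pow_le x h"] by (auto dest: nat_relD)
  then have "\<forall>h. \<exists>c. \<forall>x. smem x c \<longleftrightarrow> srel pow_le x h"
    by - (rule transferD[where A = "\<forall>h. \<exists>c. \<forall>x. mem x c \<longleftrightarrow> pow_le x h"],
      intro transfers_intros, blast)
  then show ?thesis by blast
qed

lemma star_bit_set: "\<exists>c. \<forall>x. smem x c \<longleftrightarrow> srel in_interval x h \<and> srel bit_rel i x"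
proof -
  have "\<exists>c. \<forall>x. mem x c \<longleftrightarrow> in_interval x h \<and> bit_rel i x" for h i
    using exists_subset[of NN "\<lambda>x. in_interval x h \<and> bit_rel i x"] by (auto dest: nat_relD)
  then have "\<forall>h i. \<exists>c. \<forall>x. smem x c \<longleftrightarrow> srel in_interval x h \<and> srel bit_rel i x"
    by - (rule transferD[where A = "\<forall>h i. \<exists>c. \<forall>x. mem x c \<longleftrightarrow> in_interval x h \<and> bit_rel i x"],
      intro transfers_intros, blast)
  then show ?thesis by blast
qed

lemma star_insert:
  assumes "\<And>y. smem y a \<Longrightarrow> smem y (star NN)" "smem x (star NN)"
  shows "\<exists>b. \<forall>y. smem y b \<longleftrightarrow> y = x \<or> smem y a"
proof -
  have "\<exists>b. \<forall>y. mem y b \<longleftrightarrow> y = x \<or> mem y a" if "\<forall>y. mem y a \<longrightarrow> mem y NN" "mem x NN" for a x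
    using exists_subset[of NN "\<lambda>y. y = x \<or> mem y a"] that by auto
  then have "\<forall>a x. (\<forall>y. smem y a \<longrightarrow> smem y (star NN)) \<longrightarrow> smem x (star NN) \<longrightarrow>
      (\<exists>b. \<forall>y. smem y b \<longleftrightarrow> y = x \<or> smem y a)"
    by - (rule transferD[where A = "\<forall>a x. (\<forall>y. mem y a \<longrightarrow> mem y NN) \<longrightarrow> mem x NN \<longrightarrow>
      (\<exists>b. \<forall>y. mem y b \<longleftrightarrow> y = x \<or> mem y a)"],
      intro transfers_intros, blast)
  with assms show ?thesis by blast
qed

lemma star_in_intervalD: "srel in_interval x h \<Longrightarrow> smem x (star NN)"
  and star_pow_leD: "srel pow_le x h \<Longrightarrow> smem x (star NN)"
proof -
  have "\<forall>x h. srel in_interval x h \<longrightarrow> smem x (star NN)"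
    by (rule transferD[where A = "\<forall>x h. in_interval x h \<longrightarrow> mem x NN"], intro transfers_intros)
      (auto dest: nat_relD)
  then show "srel in_interval x h \<Longrightarrow> smem x (star NN)" by blast
  have "\<forall>x h. srel pow_le x h \<longrightarrow> smem x (star NN)"
    by (rule transferD[where A = "\<forall>x h. pow_le x h \<longrightarrow> mem x NN"], intro transfers_intros)
      (auto dest: nat_relD)
  then show "srel pow_le x h \<Longrightarrow> smem x (star NN)" by blast
qed

lemma star_card_exists:
  assumes "\<And>x. smem x a \<Longrightarrow> srel in_interval x h"
  shows "\<exists>y. srel (card_rel mem num) a y"
proof -
  have "\<exists>y. card_rel mem num a y" if le: "\<forall>x. mem x a \<longrightarrow> in_interval x h" for a h
  proof -
    obtain S where "finite S" "{x. mem x a} = num ` S"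
      using finite_extension[of a h] le by blast
    then show ?thesis by (simp add: card_rel_iff)
  qed
  then have "\<forall>a h. (\<forall>x. smem x a \<longrightarrow> srel in_interval x h) \<longrightarrow> (\<exists>y. srel (card_rel mem num) a y)"
    by - (rule transferD[where A = "\<forall>a h. (\<forall>x. mem x a \<longrightarrow> in_interval x h) \<longrightarrow> (\<exists>y. card_rel mem num a y)"],
      intro transfers_intros, blast)
  with assms show ?thesis by blast
qed

lemma star_card_unique:
  assumes "srel (card_rel mem num) a y" "srel (card_rel mem num) a y'"
  shows "y = y'"
proof -
  have "y = y'" if card: "card_rel mem num a y" "card_rel mem num a y'" for a y y'
  proof -
    obtain S where "finite S" "{x. mem x a} = num ` S"
      using card(1) unfolding card_rel_def by blast
    with card show ?thesis by (simp add: card_rel_iff)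
  qed
  then have "\<forall>a y y'. srel (card_rel mem num) a y \<longrightarrow> srel (card_rel mem num) a y' \<longrightarrow> y = y'"
    by - (rule transferD[where A = "\<forall>a y y'. card_rel mem num a y \<longrightarrow> card_rel mem num a y' \<longrightarrow> y = y'"],
      intro transfers_intros, blast)
  with assms show ?thesis by blast
qed

lemma star_code_exists:
  assumes "\<And>x. smem x a \<Longrightarrow> srel in_interval x h"
  shows "\<exists>y. smem y (star NN) \<and> srel code_rel a y"
proof -
  have "\<exists>y. mem y NN \<and> code_rel a y" if le: "\<forall>x. mem x a \<longrightarrow> in_interval x h" for a h
  proof -
    obtain S where "finite S" "{x. mem x a} = num ` S"
      using finite_extension[of a h] le by blast
    then have "code_rel a (num (set_encode S))" by (simp add: code_rel_iff)
    then show ?thesis by auto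
  qed
  then have "\<forall>a h. (\<forall>x. smem x a \<longrightarrow> srel in_interval x h) \<longrightarrow> (\<exists>y. smem y (star NN) \<and> srel code_rel a y)"
    by - (rule transferD[where A = "\<forall>a h. (\<forall>x. mem x a \<longrightarrow> in_interval x h) \<longrightarrow> (\<exists>y. mem y NN \<and> code_rel a y)"],
      intro transfers_intros, blast)
  with assms show ?thesis by blast
qed

lemma star_code_inject:
  assumes "srel code_rel a y" "srel code_rel b y"
  shows "a = b"
proof -
  have "a = b" if ab: "code_rel a y" "code_rel b y" for a b y
  proof -
    obtain S T where ST: "finite S" "{x. mem x a} = num ` S" "y = num (set_encode S)"
      "finite T" "{x. mem x b} = num ` T" "y = num (set_encode T)"
      using ab unfolding code_rel_def by blast
    then have "set_encode S = set_encode T" by simp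
    with ST have "S = T" by (metis set_encode_inverse)
    with ST have "{x. mem x a} = {x. mem x b}" by simp
    then show ?thesis by (intro mem_ext) blast
  qed
  then have "\<forall>a b y. srel code_rel a y \<longrightarrow> srel code_rel b y \<longrightarrow> a = b"
    by - (rule transferD[where A = "\<forall>a b y. code_rel a y \<longrightarrow> code_rel b y \<longrightarrow> a = b"],
      intro transfers_intros, blast)
  with assms show ?thesis by blast
qed

lemma star_card_empty:
  assumes "\<And>x. \<not> smem x a"
  shows "srel (card_rel mem num) a (star (num 0))"
proof -
  have "card_rel mem num a (num 0)" if "\<forall>x. \<not> mem x a" for a
    using that card_rel_iff[of "{}"] by simp
  then have "\<forall>a. (\<forall>x. \<not> smem x a) \<longrightarrow> srel (card_rel mem num) a (star (num 0))"
    by - (rule transferD[where A = "\<forall>a. (\<forall>x. \<not> mem x a) \<longrightarrow> card_rel mem num a (num 0)"],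
      intro transfers_intros, blast)
  with assms show ?thesis by blast
qed

text \<open>The step of an external induction on finite sets. Since \<open>n\<close> is standard,
  \<open>num (Suc n)\<close> is just another parameter and no successor function has to be
  transferred.\<close>

lemma star_card_insert:
  assumes "srel (card_rel mem num) a (star (num n))" "smem x (star NN)" "\<not> smem x a"
    and "\<And>y. smem y b \<longleftrightarrow> y = x \<or> smem y a"
  shows "srel (card_rel mem num) b (star (num (Suc n)))"
proof -
  have "card_rel mem num b (num (Suc n))"
    if h: "card_rel mem num a (num n)" "mem x NN" "\<not> mem x a" "\<forall>y. mem y b \<longleftrightarrow> y = x \<or> mem y a"
    for a b x
  proof -
    obtain S where S: "finite S" "\<And>x. mem x a \<longleftrightarrow> x \<in> num ` S" "num n = num (card S)"
      using h(1) card_relE by blast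
    obtain m where m: "x = num m" using h(2) by auto
    have "m \<notin> S" using S h(3) m by blast
    moreover have "{y. mem y b} = num ` insert m S" using h(4) S m by blast
    ultimately show ?thesis
      using S card_rel_iff[of "insert m S" b] by simp
  qed
  then have "\<forall>a b x. srel (card_rel mem num) a (star (num n)) \<longrightarrow> smem x (star NN) \<longrightarrow>
      \<not> smem x a \<longrightarrow> (\<forall>y. smem y b \<longleftrightarrow> y = x \<or> smem y a) \<longrightarrow>
      srel (card_rel mem num) b (star (num (Suc n)))"
    by - (rule transferD[where A = "\<forall>a b x. card_rel mem num a (num n) \<longrightarrow> mem x NN \<longrightarrow>
      \<not> mem x a \<longrightarrow> (\<forall>y. mem y b \<longleftrightarrow> y = x \<or> mem y a) \<longrightarrow> card_rel mem num b (num (Suc n))"],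
      intro transfers_intros, blast)
  with assms show ?thesis by blast
qed

section \<open>Ratios of internal cardinalities\<close>

lemma star_ratio_ge_mono:
  assumes "srel (ratio_ge q') y h" "q \<le> q'"
  shows "srel (ratio_ge q) y h"
proof -
  have "ratio_ge q y h" if "ratio_ge q' y h" for y h
    using that mult_right_mono[OF assms(2) of_nat_0_le_iff] unfolding nat_rel_def by (metis order_trans)
  then have "\<forall>y h. srel (ratio_ge q') y h \<longrightarrow> srel (ratio_ge q) y h"
    by - (rule transferD[where A = "\<forall>y h. ratio_ge q' y h \<longrightarrow> ratio_ge q y h"],
      intro transfers_intros, blast)
  with assms show ?thesis by blast
qed

lemma star_ratio_near:
  assumes "srel (ratio_ge p) y h" "\<not> srel (ratio_ge q) y h" "r - \<epsilon> < p" "q < r + \<epsilon>"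
  shows "srel (ratio_near r \<epsilon>) y h"
proof -
  have "ratio_near r \<epsilon> y h" if h: "ratio_ge p y h" "\<not> ratio_ge q y h" for y h
  proof -
    obtain m n where mn: "y = num m" "h = num n" using h(1) unfolding nat_rel_def by blast
    with h have le: "p * real n \<le> real m" "real m < q * real n" by auto
    then have "n > 0" by (cases "n = 0") auto
    with le have "p \<le> real m / real n" "real m / real n < q" by (auto simp: field_simps)
    with assms mn show ?thesis by (auto simp: abs_if)
  qed
  then have "\<forall>y h. srel (ratio_ge p) y h \<longrightarrow> \<not> srel (ratio_ge q) y h \<longrightarrow> srel (ratio_near r \<epsilon>) y h"
    by - (rule transferD[where A = "\<forall>y h. ratio_ge p y h \<longrightarrow> \<not> ratio_ge q y h \<longrightarrow> ratio_near r \<epsilon> y h"],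
      intro transfers_intros, blast)
  with assms show ?thesis by blast
qed

text \<open>The ratio is at most 1. The constant 2 leaves room for the whole interval, because the
  negated inequality is strict.\<close>

lemma star_ratio_bounds:
  assumes "srel (card_rel mem num) a y" "\<And>x. smem x a \<Longrightarrow> srel in_interval x h" "smem h (star NN)" "h \<noteq> star (num 0)"
  shows "srel (ratio_ge 0) y h" "\<not> srel (ratio_ge 2) y h"
proof -
  have "ratio_ge 0 y h \<and> \<not> ratio_ge 2 y h"
    if h: "card_rel mem num a y" "\<forall>x. mem x a \<longrightarrow> in_interval x h" "mem h NN" "h \<noteq> num 0" for a y h
  proof -
    obtain n where n: "h = num n" "n \<noteq> 0" using h by auto
    obtain S where S: "finite S" "\<And>x. mem x a \<longleftrightarrow> x \<in> num ` S" "y = num (card S)"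
      using h(1) card_relE by blast
    have "S \<subseteq> {1..n}" using h(2) S(2) n by auto
    then have "card S \<le> n" using card_mono[of "{1..n}" S] by simp
    with n S show ?thesis by simp
  qed
  then have "\<forall>a y h. srel (card_rel mem num) a y \<longrightarrow> (\<forall>x. smem x a \<longrightarrow> srel in_interval x h) \<longrightarrow>
      smem h (star NN) \<longrightarrow> h \<noteq> star (num 0) \<longrightarrow> srel (ratio_ge 0) y h \<and> \<not> srel (ratio_ge 2) y h"
    by - (rule transferD[where A = "\<forall>a y h. card_rel mem num a y \<longrightarrow> (\<forall>x. mem x a \<longrightarrow> in_interval x h) \<longrightarrow>
      mem h NN \<longrightarrow> h \<noteq> num 0 \<longrightarrow> ratio_ge 0 y h \<and> \<not> ratio_ge 2 y h"],
      intro transfers_intros, blast)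
  with assms show "srel (ratio_ge 0) y h" "\<not> srel (ratio_ge 2) y h" by blast+
qed

lemma star_ratio_near_unique:
  assumes "srel (ratio_near r \<epsilon>) y h" "srel (ratio_near r' \<epsilon>) y h"
  shows "\<bar>r - r'\<bar> < 2 * \<epsilon>"
proof (rule ccontr)
  assume "\<not> \<bar>r - r'\<bar> < 2 * \<epsilon>"
  then have "\<not> (ratio_near r \<epsilon> y h \<and> ratio_near r' \<epsilon> y h)" for y h
    unfolding nat_rel_def by auto
  then have "\<forall>y h. \<not> (srel (ratio_near r \<epsilon>) y h \<and> srel (ratio_near r' \<epsilon>) y h)"
    by - (rule transferD[where A = "\<forall>y h. \<not> (ratio_near r \<epsilon> y h \<and> ratio_near r' \<epsilon> y h)"],
      intro transfers_intros, blast)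
  with assms show False by blast
qed

lemma star_ratio_near_nonneg:
  assumes "srel (ratio_near r \<epsilon>) y h"
  shows "- \<epsilon> < r"
proof (rule ccontr)
  assume *: "\<not> - \<epsilon> < r"
  have "\<not> ratio_near r \<epsilon> y h" for y h
  proof
    assume "ratio_near r \<epsilon> y h"
    then obtain m n :: nat where "\<bar>real m / real n - r\<bar> < \<epsilon>" unfolding nat_rel_def by blast
    moreover have "0 \<le> real m / real n" by simp
    ultimately show False using * by linarith
  qed
  then have "\<forall>y h. \<not> srel (ratio_near r \<epsilon>) y h"
    by - (rule transferD[where A = "\<forall>y h. \<not> ratio_near r \<epsilon> y h"],
      intro transfers_intros, blast)
  with assms show False by blast
qed

lemma star_ratio_near_full:
  assumes "srel (card_rel mem num) c y" "\<And>x. smem x c \<longleftrightarrow> srel in_interval x h" "smem h (star NN)" "h \<noteq> star (num 0)"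
    and "0 < \<epsilon>"
  shows "srel (ratio_near 1 \<epsilon>) y h"
proof -
  have "ratio_near 1 \<epsilon> y h"
    if h: "card_rel mem num c y" "\<forall>x. mem x c \<longleftrightarrow> in_interval x h" "mem h NN" "h \<noteq> num 0" for c y h
  proof -
    obtain n where n: "h = num n" "n \<noteq> 0" using h by auto
    have "{x. mem x c} = num ` {1..n}"
      using h(2) n by (auto simp: nat_rel_def)
    then have "y = num n" using h(1) card_rel_iff[of "{1..n}"] by simp
    with n \<open>0 < \<epsilon>\<close> show ?thesis by simp
  qed
  then have "\<forall>c y h. srel (card_rel mem num) c y \<longrightarrow> (\<forall>x. smem x c \<longleftrightarrow> srel in_interval x h) \<longrightarrow>
      smem h (star NN) \<longrightarrow> h \<noteq> star (num 0) \<longrightarrow> srel (ratio_near 1 \<epsilon>) y h"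
    by - (rule transferD[where A = "\<forall>c y h. card_rel mem num c y \<longrightarrow> (\<forall>x. mem x c \<longleftrightarrow> in_interval x h) \<longrightarrow>
      mem h NN \<longrightarrow> h \<noteq> num 0 \<longrightarrow> ratio_near 1 \<epsilon> y h"],
      intro transfers_intros, blast)
  with assms show ?thesis by blast
qed

lemma star_ratio_near_add:
  assumes "srel (card_rel mem num) a x" "srel (card_rel mem num) b y" "srel (card_rel mem num) c z"
    and "\<And>u. \<not> (smem u a \<and> smem u b)" "\<And>u. smem u c \<longleftrightarrow> smem u a \<or> smem u b"
    and "srel (ratio_near r \<epsilon>) x h" "srel (ratio_near r' \<epsilon>) y h"
  shows "srel (ratio_near (r + r') (2 * \<epsilon>)) z h"
proof -
  have "ratio_near (r + r') (2 * \<epsilon>) z h"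
    if h: "card_rel mem num a x" "card_rel mem num b y" "card_rel mem num c z"
      "\<forall>u. \<not> (mem u a \<and> mem u b)" "\<forall>u. mem u c \<longleftrightarrow> mem u a \<or> mem u b"
      "ratio_near r \<epsilon> x h" "ratio_near r' \<epsilon> y h" for a b c x y z h
  proof -
    obtain A where A: "finite A" "\<And>u. mem u a \<longleftrightarrow> u \<in> num ` A" "x = num (card A)"
      using h(1) card_relE by blast
    obtain B where B: "finite B" "\<And>u. mem u b \<longleftrightarrow> u \<in> num ` B" "y = num (card B)"
      using h(2) card_relE by blast
    have "A \<inter> B = {}" using h(4) A(2) B(2) by blast
    have "{u. mem u c} = num ` (A \<union> B)" using h(5) A(2) B(2) by blast
    then have z: "z = num (card A + card B)"
      using h(3) card_rel_iff[of "A \<union> B" c z] A(1) B(1) \<open>A \<inter> B = {}\<close> by (simp add: card_Un_disjoint)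
    obtain n where n: "h = num n" using h(6) by (auto simp: nat_rel_def)
    show ?thesis using h(6,7) A(3) B(3) unfolding z n by (simp add: add_divide_distrib)
  qed
  then have "\<forall>a b c x y z h. srel (card_rel mem num) a x \<longrightarrow> srel (card_rel mem num) b y \<longrightarrow>
      srel (card_rel mem num) c z \<longrightarrow> (\<forall>u. \<not> (smem u a \<and> smem u b)) \<longrightarrow>
      (\<forall>u. smem u c \<longleftrightarrow> smem u a \<or> smem u b) \<longrightarrow> srel (ratio_near r \<epsilon>) x h \<longrightarrow>
      srel (ratio_near r' \<epsilon>) y h \<longrightarrow> srel (ratio_near (r + r') (2 * \<epsilon>)) z h"
    by - (rule transferD[where A = "\<forall>a b c x y z h. card_rel mem num a x \<longrightarrow> card_rel mem num b y \<longrightarrow>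
      card_rel mem num c z \<longrightarrow> (\<forall>u. \<not> (mem u a \<and> mem u b)) \<longrightarrow>
      (\<forall>u. mem u c \<longleftrightarrow> mem u a \<or> mem u b) \<longrightarrow> ratio_near r \<epsilon> x h \<longrightarrow>
      ratio_near r' \<epsilon> y h \<longrightarrow> ratio_near (r + r') (2 * \<epsilon>) z h"],
      intro transfers_intros, blast)
  with assms show ?thesis by blast
qed

text \<open>Every ratio up to \<open>2 / 2 ^ k\<close> has distance at least \<epsilon> from
  \<open>r\<close>, so the strict inequality in \<open>ratio_near\<close> fails. The form is chosen
  so that \<epsilon> can be the excess of a content over the bound.\<close>

lemma not_ratio_near_of_card_le:
  assumes "card S * 2 ^ k \<le> 2 * n" "r = 2 / 2 ^ k + \<epsilon>" "0 < \<epsilon>"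
  shows "\<not> ratio_near r \<epsilon> (num (card S)) (num n)"
proof -
  have "real (card S) / real n \<le> 2 / 2 ^ k"
  proof (cases "n = 0")
    case False
    have "real (card S * 2 ^ k) \<le> real (2 * n)" using assms(1) of_nat_mono by blast
    with False show ?thesis by (simp add: field_simps)
  qed simp
  with assms show ?thesis by simp
qed

lemma card_rel_bits_bound:
  assumes "\<forall>i. mem i f \<longrightarrow> pow_le i h" "card_rel mem num f (num k)" "card_rel mem num c y"
    and c: "(\<forall>x. mem x c \<longleftrightarrow> in_interval x h \<and> (\<forall>i. mem i f \<longrightarrow> bit_rel i x)) \<or>
      (\<forall>x. mem x c \<longleftrightarrow> in_interval x h \<and> (\<forall>i. mem i f \<longrightarrow> \<not> bit_rel i x))"
    and "r = 2 / 2 ^ k + \<epsilon>" "0 < \<epsilon>"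
  shows "\<not> ratio_near r \<epsilon> y h"
proof
  assume near: "ratio_near r \<epsilon> y h"
  then obtain n where n: "h = num n" by (auto simp: nat_rel_def)
  obtain F where F: "finite F" "\<And>x. mem x f \<longleftrightarrow> x \<in> num ` F" "num k = num (card F)"
    using assms(2) card_relE by blast
  obtain C where C: "finite C" "\<And>x. mem x c \<longleftrightarrow> x \<in> num ` C" "y = num (card C)"
    using assms(3) card_relE by blast
  have C_iff: "m \<in> C \<longleftrightarrow> mem (num m) c" for m using C(2) by auto
  have pow: "2 ^ i \<le> n" if "i \<in> F" for i using assms(1) F(2) n that by auto
  have "card C * 2 ^ k \<le> 2 * n"
  proof (cases "n = 0")
    case True
    then have "C = {}" using C_iff c n by auto
    then show ?thesis by simp
  next
    case False
    then have "1 \<le> n" by simp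
    note le = card_bits_le[OF F(1) pow this]
    from c show ?thesis
    proof
      assume "\<forall>x. mem x c \<longleftrightarrow> in_interval x h \<and> (\<forall>i. mem i f \<longrightarrow> bit_rel i x)"
      then have "C \<subseteq> {m. m \<le> n \<and> F \<subseteq> set_decode m}" using C_iff F(2) n by (auto simp: image_iff) (metis nat_rel_num)
      then have "card C \<le> card {m. m \<le> n \<and> F \<subseteq> set_decode m}" by (intro card_mono) auto
      with le(1) F(3) show ?thesis by (metis le_trans mult_le_mono1 num_eq_iff)
    next
      assume "\<forall>x. mem x c \<longleftrightarrow> in_interval x h \<and> (\<forall>i. mem i f \<longrightarrow> \<not> bit_rel i x)"
      then have "C \<subseteq> {m. m \<le> n \<and> set_decode m \<inter> F = {}}" using C_iff F(2) n by (auto simp: image_iff) (metis nat_rel_num)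
      then have "card C \<le> card {m. m \<le> n \<and> set_decode m \<inter> F = {}}" by (intro card_mono) auto
      with le(2) F(3) show ?thesis by (metis le_trans mult_le_mono1 num_eq_iff)
    qed
  qed
  with near C(3) n assms(5,6) not_ratio_near_of_card_le show False by blast
qed

lemma star_bits_bound:
  assumes "\<And>i. smem i f \<Longrightarrow> srel pow_le i h" "srel (card_rel mem num) f (star (num k))"
    and "srel (card_rel mem num) c y"
    and "(\<forall>x. smem x c \<longleftrightarrow> srel in_interval x h \<and> (\<forall>i. smem i f \<longrightarrow> srel bit_rel i x)) \<or>
      (\<forall>x. smem x c \<longleftrightarrow> srel in_interval x h \<and> (\<forall>i. smem i f \<longrightarrow> \<not> srel bit_rel i x))"
    and "0 < \<epsilon>"
  shows "\<not> srel (ratio_near (2 / 2 ^ k + \<epsilon>) \<epsilon>) y h"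
proof -
  have "\<forall>f h c y. (\<forall>i. smem i f \<longrightarrow> srel pow_le i h) \<longrightarrow> srel (card_rel mem num) f (star (num k)) \<longrightarrow>
      srel (card_rel mem num) c y \<longrightarrow>
      ((\<forall>x. smem x c \<longleftrightarrow> srel in_interval x h \<and> (\<forall>i. smem i f \<longrightarrow> srel bit_rel i x)) \<or>
      (\<forall>x. smem x c \<longleftrightarrow> srel in_interval x h \<and> (\<forall>i. smem i f \<longrightarrow> \<not> srel bit_rel i x))) \<longrightarrow>
      \<not> srel (ratio_near (2 / 2 ^ k + \<epsilon>) \<epsilon>) y h"
    by (rule transferD[where A = "\<forall>f h c y. (\<forall>i. mem i f \<longrightarrow> pow_le i h) \<longrightarrow>
      card_rel mem num f (num k) \<longrightarrow> card_rel mem num c y \<longrightarrow>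
      ((\<forall>x. mem x c \<longleftrightarrow> in_interval x h \<and> (\<forall>i. mem i f \<longrightarrow> bit_rel i x)) \<or>
      (\<forall>x. mem x c \<longleftrightarrow> in_interval x h \<and> (\<forall>i. mem i f \<longrightarrow> \<not> bit_rel i x))) \<longrightarrow>
      \<not> ratio_near (2 / 2 ^ k + \<epsilon>) \<epsilon> y h"], intro transfers_intros)
      (use card_rel_bits_bound \<open>0 < \<epsilon>\<close> in blast)
  with assms show ?thesis by blast
qed

lemma star_num_eq_iff [simp]: "star (num m) = star (num n) \<longleftrightarrow> m = n"
proof -
  have "star (num m) \<noteq> star (num n)" if "m \<noteq> n"
    by (rule transferD[where A = "num m \<noteq> num n"], intro transfers_intros) (use that in simp)
  then show ?thesis by blast
qed

text \<open>External induction on \<open>n\<close>: a standard numeral acquires no new members in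
  the extension.\<close>

lemma smem_star_num: "smem x (star (num n)) \<longleftrightarrow> x \<in> (star \<circ> num) ` {..<n}"
proof (induction n arbitrary: x)
  case 0
  have "\<forall>x. \<not> smem x (star (num 0))"
    by (rule transferD[where A = "\<forall>x. \<not> mem x (num 0)"], intro transfers_intros) (simp add: mem_num)
  then show ?case by simp
next
  case (Suc n)
  have "\<forall>x. smem x (star (num (Suc n))) \<longleftrightarrow> x = star (num n) \<or> smem x (star (num n))"
    by (rule transferD[where A = "\<forall>x. mem x (num (Suc n)) \<longleftrightarrow> x = num n \<or> mem x (num n)"],
      intro transfers_intros) (auto simp: mem_num lessThan_Suc)
  with Suc show ?case by (auto simp: lessThan_Suc)
qed

text \<open>For von Neumann numerals order is membership. An infinite \<open>h\<close> is not among
  the members of \<open>star (num (2 ^ n))\<close>, which are all standard, so transfer gives that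
  \<open>h\<close> is at least \<open>2 ^ n\<close>.\<close>

lemma star_pow_le_num:
  assumes "smem h (star NN)" "h \<notin> range (star \<circ> num)"
  shows "srel pow_le (star (num n)) h"
proof -
  have "pow_le (num n) h" if "mem h NN" "\<not> mem h (num (2 ^ n))" for h
    using that by auto
  then have "\<forall>h. smem h (star NN) \<longrightarrow> \<not> smem h (star (num (2 ^ n))) \<longrightarrow> srel pow_le (star (num n)) h"
    by - (rule transferD[where A = "\<forall>h. mem h NN \<longrightarrow> \<not> mem h (num (2 ^ n)) \<longrightarrow> pow_le (num n) h"],
      intro transfers_intros, blast)
  with assms show ?thesis by (auto simp: smem_star_num)
qed

end

section \<open>The Loeb content\<close>

locale hyperfinite_space = universe_pair mem num smem star
  for mem :: "'v \<Rightarrow> 'v \<Rightarrow> bool" and num :: "nat \<Rightarrow> 'v"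
    and smem :: "'w \<Rightarrow> 'w \<Rightarrow> bool" and star :: "'v \<Rightarrow> 'w" +
  fixes H :: 'w
  assumes infinite_H: "H \<in> infinite_hypernats mem num smem star"
begin

definition Omega :: "'w set" where "Omega = hyperfinite_interval mem num smem star H"

definition internal_subsets :: "'w set set" where "internal_subsets = {A \<in> internal_sets mem num smem star. A \<subseteq> Omega}"

definition loeb_content :: "'w set \<Rightarrow> real" where
  "loeb_content A = st_ratio mem num smem star (internal_card mem num smem star A) H"

text \<open>The places where some number up to \<open>H\<close> can have the digit 1; the
  coordinates \<open>K\<close> are selected among them.\<close>

definition bit_positions :: "'w set" where "bit_positions = {i. srel pow_le i H}"

definition bit_set :: "'w \<Rightarrow> 'w set" where "bit_set i = {x. srel bit_rel i x}"

lemma H: "smem H (star NN)" "H \<notin> range (star \<circ> num)"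
  using infinite_H by (auto simp: infinite_hypernats_def hypernats_def star_set_def)

lemma H_ne_0: "H \<noteq> star (num 0)"
  using H(2) by auto

lemma internalI: "(\<And>y. smem y a \<Longrightarrow> smem y (star NN)) \<Longrightarrow> {x. smem x a} \<in> internal_sets mem num smem star"
  unfolding internal_sets_def truncation_def star_set_def using star_subset_NN by blast

lemma Omega_iff: "x \<in> Omega \<longleftrightarrow> srel in_interval x H"
  by (simp add: Omega_def hyperfinite_interval_def)

text \<open>Elements of \<open>Omega\<close> are hypernaturals, so membership of the code in the
  truncation is automatic.\<close>

lemma internal_subsets_iff: "A \<in> internal_subsets \<longleftrightarrow> A \<subseteq> Omega \<and> (\<exists>a. A = {x. smem x a})"
proof
  assume "A \<in> internal_subsets"
  then show "A \<subseteq> Omega \<and> (\<exists>a. A = {x. smem x a})" by (auto simp: internal_subsets_def internal_sets_def)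
next
  assume A: "A \<subseteq> Omega \<and> (\<exists>a. A = {x. smem x a})"
  then obtain a where a: "A = {x. smem x a}" by blast
  have "smem y (star NN)" if "smem y a" for y
    using that star_in_intervalD A a Omega_iff by blast
  from internalI[OF this] A a show "A \<in> internal_subsets" by (simp add: internal_subsets_def)
qed

lemma Omega_in_internal_subsets: "Omega \<in> internal_subsets"
proof -
  obtain c where c: "\<forall>x. smem x c \<longleftrightarrow> srel in_interval x H" using star_interval[of H] ..
  then have "Omega = {x. smem x c}" unfolding set_eq_iff mem_Collect_eq Omega_iff by blast
  then show ?thesis by (auto simp: internal_subsets_iff)
qed

lemma internal_subsets_Diff:
  assumes "A \<in> internal_subsets" "B \<in> internal_subsets"
  shows "A - B \<in> internal_subsets"
proof -
  obtain a b where ab: "A = {x. smem x a}" "B = {x. smem x b}" using assms by (auto simp: internal_subsets_iff)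
  obtain c where "\<And>x. smem x c \<longleftrightarrow> smem x a \<and> \<not> smem x b" using star_diff[of a b] by auto
  with ab have "A - B = {x. smem x c}" by auto
  with assms(1) show ?thesis by (auto simp: internal_subsets_iff)
qed

lemma algebra_internal_subsets: "algebra Omega internal_subsets"
proof -
  have "internal_subsets \<subseteq> Pow Omega" by (auto simp: internal_subsets_iff)
  moreover have "{} \<in> internal_subsets" using internal_subsets_Diff[OF Omega_in_internal_subsets Omega_in_internal_subsets] by simp
  moreover have "A \<union> B \<in> internal_subsets" if "A \<in> internal_subsets" "B \<in> internal_subsets" for A B
  proof -
    have "A \<union> B = Omega - ((Omega - A) - B)" using that by (auto simp: internal_subsets_iff)
    also have "\<dots> \<in> internal_subsets" using that by (intro internal_subsets_Diff Omega_in_internal_subsets)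
    finally show ?thesis .
  qed
  ultimately show ?thesis
    using internal_subsets_Diff Omega_in_internal_subsets by (auto simp: algebra_iff_Un)
qed

text \<open>The description operator in \<open>internal_card\<close> is justified by extensionality,
  which determines the code \<open>a\<close>, and by uniqueness of the cardinality of
  \<open>a\<close>.\<close>

lemma internal_card_rel:
  assumes "{x. smem x a} \<subseteq> Omega"
  shows "srel (card_rel mem num) a (internal_card mem num smem star {x. smem x a})"
proof -
  obtain y where y: "srel (card_rel mem num) a y"
    using star_card_exists[of a H] assms Omega_iff by blast
  have "internal_card mem num smem star {x. smem x a} = y"
    unfolding internal_card_def
  proof (rule the_equality)
    show "\<exists>b. {x. smem x b} = {x. smem x a} \<and> srel (card_rel mem num) b y" using y by blast
    fix h assume "\<exists>b. {x. smem x b} = {x. smem x a} \<and> srel (card_rel mem num) b h"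
    then obtain b where b: "{x. smem x b} = {x. smem x a}" "srel (card_rel mem num) b h" by blast
    then have "b = a" by (intro star_ext) auto
    with b y show "h = y" using star_card_unique by blast
  qed
  with y show ?thesis by simp
qed

text \<open>The standard part exists as the supremum of the real cut \<open>Q\<close>, which is
  bounded because the ratio lies between 0 and 2. Uniqueness follows by taking half the distance
  between two candidates as tolerance.\<close>

lemma loeb_content_near:
  assumes a: "{x. smem x a} \<subseteq> Omega" and "0 < \<epsilon>"
  shows "srel (ratio_near (loeb_content {x. smem x a}) \<epsilon>) (internal_card mem num smem star {x. smem x a}) H"
proof -
  define y where "y = internal_card mem num smem star {x. smem x a}"
  have y: "srel (card_rel mem num) a y" using internal_card_rel[OF a] by (simp add: y_def)
  have "srel in_interval x H" if "smem x a" for x using a that by (auto simp: Omega_iff)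
  note bounds = star_ratio_bounds[OF y this H(1) H_ne_0]
  define Q where "Q = {q. srel (ratio_ge q) y H}"
  have Q: "0 \<in> Q" "bdd_above Q"
    using bounds star_ratio_ge_mono by (auto simp: Q_def intro!: bdd_aboveI[of _ 2]) (meson linear)
  have near: "srel (ratio_near (Sup Q) e) y H" if "0 < e" for e
  proof -
    obtain p where p: "p \<in> Q" "Sup Q - e < p"
      using less_cSup_iff[of Q "Sup Q - e"] Q \<open>0 < e\<close> by auto
    have "Sup Q + e / 2 \<notin> Q"
      using cSup_upper[OF _ Q(2), of "Sup Q + e / 2"] \<open>0 < e\<close> by auto
    with p \<open>0 < e\<close> show ?thesis
      by (intro star_ratio_near[where p = p and q = "Sup Q + e / 2"]) (auto simp: Q_def)
  qed
  have "loeb_content {x. smem x a} = Sup Q"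
    unfolding loeb_content_def st_ratio_def y_def[symmetric]
  proof (rule the_equality)
    show "\<forall>\<epsilon>>0. srel (ratio_near (Sup Q) \<epsilon>) y H" using near by blast
    fix r assume r: "\<forall>\<epsilon>>0. srel (ratio_near r \<epsilon>) y H"
    show "r = Sup Q"
    proof (rule ccontr)
      assume "r \<noteq> Sup Q"
      then have "0 < \<bar>r - Sup Q\<bar> / 2" by simp
      from star_ratio_near_unique[OF r[rule_format, OF this] near[OF this]] show False by simp
    qed
  qed
  with near \<open>0 < \<epsilon>\<close> show ?thesis by (simp add: y_def)
qed

lemma loeb_content_eqI:
  assumes a: "{x. smem x a} \<subseteq> Omega"
    and "\<And>\<epsilon>. 0 < \<epsilon> \<Longrightarrow> srel (ratio_near r \<epsilon>) (internal_card mem num smem star {x. smem x a}) H"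
  shows "loeb_content {x. smem x a} = r"
proof (rule ccontr)
  let ?l = "loeb_content {x. smem x a}"
  assume "?l \<noteq> r"
  then have "0 < \<bar>?l - r\<bar> / 2" by simp
  from star_ratio_near_unique[OF loeb_content_near[OF a this] assms(2)[OF this]] show False by simp
qed

lemma loeb_content_nonneg:
  assumes "A \<in> internal_subsets"
  shows "0 \<le> loeb_content A"
proof (rule ccontr)
  assume "\<not> 0 \<le> loeb_content A"
  then have "0 < - loeb_content A" by simp
  moreover obtain a where "A = {x. smem x a}" "A \<subseteq> Omega" using assms by (auto simp: internal_subsets_iff)
  ultimately show False
    using star_ratio_near_nonneg[OF loeb_content_near[of a "- loeb_content A"]] by simp
qed

lemma loeb_content_Omega: "loeb_content Omega = 1"
proof -
  obtain c where c: "Omega = {x. smem x c}" using Omega_in_internal_subsets by (auto simp: internal_subsets_iff)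
  show ?thesis
    unfolding c
  proof (rule loeb_content_eqI)
    show sub: "{x. smem x c} \<subseteq> Omega" using c by simp
    have "smem x c \<longleftrightarrow> srel in_interval x H" for x using c Omega_iff by blast
    then show "srel (ratio_near 1 \<epsilon>) (internal_card mem num smem star {x. smem x c}) H" if "0 < \<epsilon>" for \<epsilon>
      by (rule star_ratio_near_full[OF internal_card_rel[OF sub] _ H(1) H_ne_0 that])
  qed
qed

lemma loeb_content_add:
  assumes "A \<in> internal_subsets" "B \<in> internal_subsets" "A \<inter> B = {}"
  shows "loeb_content (A \<union> B) = loeb_content A + loeb_content B"
proof -
  interpret algebra Omega internal_subsets by (rule algebra_internal_subsets)
  obtain a where a: "A = {x. smem x a}" "{x. smem x a} \<subseteq> Omega" using assms(1) by (auto simp: internal_subsets_iff)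
  obtain b where b: "B = {x. smem x b}" "{x. smem x b} \<subseteq> Omega" using assms(2) by (auto simp: internal_subsets_iff)
  obtain c where c: "A \<union> B = {x. smem x c}" "{x. smem x c} \<subseteq> Omega"
    using Un[OF assms(1,2)] by (auto simp: internal_subsets_iff)
  have disj: "\<not> (smem u a \<and> smem u b)" and un: "smem u c \<longleftrightarrow> smem u a \<or> smem u b" for u
    using assms(3) a(1) b(1) c(1) by blast+
  show ?thesis
    unfolding c(1)
  proof (rule loeb_content_eqI[OF c(2)])
    fix \<epsilon> :: real assume "0 < \<epsilon>"
    then have e: "0 < \<epsilon> / 2" by simp
    from star_ratio_near_add[OF internal_card_rel[OF a(2)] internal_card_rel[OF b(2)] internal_card_rel[OF c(2)] disj un
        loeb_content_near[OF a(2) e] loeb_content_near[OF b(2) e]]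
    show "srel (ratio_near (loeb_content A + loeb_content B) \<epsilon>) (internal_card mem num smem star {x. smem x c}) H"
      using a(1) b(1) by simp
  qed
qed

text \<open>Adding one point at a time shows that a finite set of hypernaturals is internal with its
  true cardinality, so the transferred digit count applies to finite sets of nonstandard
  places.\<close>

lemma internal_finite_set:
  assumes "finite F" "\<And>x. x \<in> F \<Longrightarrow> smem x (star NN)"
  shows "\<exists>f. F = {x. smem x f} \<and> srel (card_rel mem num) f (star (num (card F)))"
  using assms
proof (induction F rule: finite_induct)
  case empty
  have "{} \<in> internal_subsets" using algebra_internal_subsets by (simp add: algebra_iff_Un)
  then obtain f where "{} = {x. smem x f}" by (auto simp: internal_subsets_iff)
  then show ?case using star_card_empty[of f] by auto
next
  case (insert x F)
  then obtain f where f: "F = {x. smem x f}" "srel (card_rel mem num) f (star (num (card F)))" by auto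
  obtain b where b: "\<And>y. smem y b \<longleftrightarrow> y = x \<or> smem y f"
    using star_insert[of f x] insert.prems f(1) by blast
  have "\<not> smem x f" using insert.hyps f(1) by blast
  from star_card_insert[OF f(2) _ this b] insert.prems
  have "srel (card_rel mem num) b (star (num (Suc (card F))))" by simp
  moreover have "insert x F = {x. smem x b}" using b f(1) by blast
  ultimately show ?case using insert.hyps by (intro exI[of _ b]) (metis card_insert_disjoint)
qed

lemma bit_set_in_internal_subsets: "Omega \<inter> bit_set i \<in> internal_subsets"
proof -
  obtain c where "\<forall>x. smem x c \<longleftrightarrow> srel in_interval x H \<and> srel bit_rel i x" using star_bit_set[of H i] ..
  then have "Omega \<inter> bit_set i = {x. smem x c}"
    unfolding set_eq_iff Int_iff mem_Collect_eq Omega_iff bit_set_def by blast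
  then show ?thesis by (auto simp: internal_subsets_iff)
qed

lemma bit_positions_NN: "i \<in> bit_positions \<Longrightarrow> smem i (star NN)"
  using star_pow_leD by (auto simp: bit_positions_def)

text \<open>By contradiction, with the excess over the bound as tolerance:
  \<open>loeb_content_near\<close> asserts precisely the closeness that
  \<open>star_bits_bound\<close> excludes.\<close>

lemma loeb_content_le_bits:
  assumes F: "finite F" "F \<subseteq> bit_positions" and C: "C \<in> internal_subsets"
    and "C = {x \<in> Omega. \<forall>i\<in>F. x \<in> bit_set i} \<or> C = {x \<in> Omega. \<forall>i\<in>F. x \<notin> bit_set i}"
  shows "loeb_content C \<le> 2 / 2 ^ card F"
proof (rule ccontr)
  assume "\<not> loeb_content C \<le> 2 / 2 ^ card F"
  then have e: "0 < loeb_content C - 2 / 2 ^ card F" by simp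
  obtain c where c: "C = {x. smem x c}" "{x. smem x c} \<subseteq> Omega" using C by (auto simp: internal_subsets_iff)
  obtain f where f: "F = {x. smem x f}" "srel (card_rel mem num) f (star (num (card F)))"
    using internal_finite_set[OF F(1)] F(2) bit_positions_NN by blast
  have pow: "srel pow_le i H" if "smem i f" for i using F(2) f(1) that by (auto simp: bit_positions_def)
  have "(\<forall>x. smem x c \<longleftrightarrow> srel in_interval x H \<and> (\<forall>i. smem i f \<longrightarrow> srel bit_rel i x)) \<or>
      (\<forall>x. smem x c \<longleftrightarrow> srel in_interval x H \<and> (\<forall>i. smem i f \<longrightarrow> \<not> srel bit_rel i x))"
    using assms(4)
  proof (elim disjE)
    assume C: "C = {x \<in> Omega. \<forall>i\<in>F. x \<in> bit_set i}"
    have "smem x c \<longleftrightarrow> x \<in> C" for x using c(1) by simp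
    then show ?thesis unfolding C by (auto simp: f(1) Omega_iff bit_set_def)
  next
    assume C: "C = {x \<in> Omega. \<forall>i\<in>F. x \<notin> bit_set i}"
    have "smem x c \<longleftrightarrow> x \<in> C" for x using c(1) by simp
    then show ?thesis unfolding C by (auto simp: f(1) Omega_iff bit_set_def)
  qed
  from star_bits_bound[OF pow f(2) internal_card_rel[OF c(2)] this e] loeb_content_near[OF c(2) e] c(1)
  show False by simp
qed

lemma infinite_bit_positions: "infinite bit_positions"
proof -
  have "range (star \<circ> num) \<subseteq> bit_positions" using star_pow_le_num[OF H] by (auto simp: bit_positions_def)
  moreover have "inj (star \<circ> num)" by (auto simp: inj_def)
  ultimately show ?thesis using range_inj_infinite infinite_super by blast
qed

text \<open>An infinite internal set is never smaller than the degree of saturation: deleting its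
  points one at a time gives internal sets with the finite intersection property but without a
  common point.\<close>

lemma bit_positions_large:
  assumes "saturated mem num smem star \<mu>"
  shows "\<not> |bit_positions| <o \<mu>"
proof
  assume small: "|bit_positions| <o \<mu>"
  obtain c where c: "\<And>x. smem x c \<longleftrightarrow> x \<in> bit_positions" using star_pow_interval[of H] by (auto simp: bit_positions_def)
  define \<F> where "\<F> = (\<lambda>i. bit_positions - {i}) ` bit_positions"
  have "\<F> \<subseteq> internal_sets mem num smem star"
  proof
    fix A assume "A \<in> \<F>"
    then obtain i where i: "i \<in> bit_positions" "A = bit_positions - {i}" by (auto simp: \<F>_def)
    obtain f where f: "{i} = {x. smem x f}" using internal_finite_set[of "{i}"] bit_positions_NN i(1) by blast
    obtain d where d: "\<And>x. smem x d \<longleftrightarrow> smem x c \<and> \<not> smem x f" using star_diff[of c f] by auto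
    have "A = {x. smem x d}" using i(2) c d f by blast
    moreover have "{x. smem x d} \<in> internal_sets mem num smem star"
      by (rule internalI) (use c d bit_positions_NN in blast)
    ultimately show "A \<in> internal_sets mem num smem star" by simp
  qed
  moreover have "|\<F>| <o \<mu>"
    unfolding \<F>_def using card_of_image small ordLeq_ordLess_trans by blast
  moreover have "fip \<F>"
    unfolding fip_def
  proof (intro allI impI)
    fix G assume "G \<subseteq> \<F>" "finite G"
    then obtain J where J: "J \<subseteq> bit_positions" "finite J" "G = (\<lambda>i. bit_positions - {i}) ` J"
      unfolding \<F>_def by (meson finite_subset_image)
    obtain x where "x \<in> bit_positions - J" using infinite_bit_positions J(2) by (meson Diff_eq_empty_iff equals0I finite_subset)
    then have "x \<in> \<Inter>G" using J by auto
    then show "\<Inter>G \<noteq> {}" by blast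
  qed
  ultimately obtain x where "x \<in> \<Inter>\<F>" using assms unfolding saturated_def by blast
  moreover obtain i where "i \<in> bit_positions" using infinite_bit_positions by fastforce
  ultimately show False unfolding \<F>_def by blast
qed

text \<open>An internal subset of \<open>Omega\<close> is determined by its internal binary code, a
  hypernatural.\<close>

lemma card_internal_subsets: "|internal_subsets| \<le>o |hypernats mem num smem star|"
proof -
  have "\<exists>y a. A = {x. smem x a} \<and> smem y (star NN) \<and> srel code_rel a y" if "A \<in> internal_subsets" for A
  proof -
    obtain a where a: "A = {x. smem x a}" "A \<subseteq> Omega" using \<open>A \<in> internal_subsets\<close> by (auto simp: internal_subsets_iff)
    then have "srel in_interval x H" if "smem x a" for x using that by (auto simp: Omega_iff)
    from star_code_exists[OF this] a show ?thesis by blast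
  qed
  then obtain y where y: "\<And>A. A \<in> internal_subsets \<Longrightarrow> \<exists>a. A = {x. smem x a} \<and> smem (y A) (star NN) \<and> srel code_rel a (y A)"
    by metis
  have "inj_on y internal_subsets"
  proof (rule inj_onI)
    fix A B assume AB: "A \<in> internal_subsets" "B \<in> internal_subsets" "y A = y B"
    obtain a where a: "A = {x. smem x a}" "srel code_rel a (y A)" using y[OF AB(1)] by blast
    obtain b where b: "B = {x. smem x b}" "srel code_rel b (y B)" using y[OF AB(2)] by blast
    show "A = B" using star_code_inject[OF a(2)] b AB(3) a(1) by simp
  qed
  moreover have "y ` internal_subsets \<subseteq> hypernats mem num smem star"
    using y by (auto simp: hypernats_def star_set_def)
  ultimately show ?thesis using card_of_ordLeq by blast
qed

lemma internal_subsets_saturated: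
  assumes "saturated mem num smem star \<mu>" "\<F> \<subseteq> internal_subsets" "|\<F>| <o \<mu>" "fip \<F>"
  shows "\<Inter>\<F> \<noteq> {}"
  using assms unfolding saturated_def internal_subsets_def by blast

lemma loeb_space_eq:
  "loeb_space mem num smem star H =
    completion (extend_measure Omega internal_subsets (\<lambda>A. A) (\<lambda>A. ennreal (loeb_content A)))"
  by (simp add: loeb_space_def Omega_def internal_subsets_def loeb_content_def)

end

lemma countable_ordLess_cardSuc:
  assumes "countable \<G>"
  shows "|\<G>| <o cardSuc natLeq"
proof -
  obtain f :: "'a \<Rightarrow> nat" where "inj_on f \<G>" using assms unfolding countable_def by blast
  then have "|\<G>| \<le>o |UNIV :: nat set|" by (rule card_of_ordLeqI) simp
  then have "|\<G>| \<le>o natLeq" using card_of_nat by (rule ordLeq_ordIso_trans)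
  then show ?thesis
    using cardSuc_ordLeq_ordLess[OF natLeq_Card_order card_of_Card_order] by blast
qed

theorem theorem8:
  fixes \<kappa> :: "'k rel" and lam :: "'l rel"
    and mem :: "'v \<Rightarrow> 'v \<Rightarrow> bool" and num :: "nat \<Rightarrow> 'v"
    and smem :: "'w \<Rightarrow> 'w \<Rightarrow> bool" and star :: "'v \<Rightarrow> 'w"
  assumes "strong_limit \<kappa>"
    and "has_cofinality \<kappa> natLeq"
    and "Card_order lam"
    and "lam =o cardSuc \<kappa>"
    and "lam =o ctwo ^c \<kappa>"
    and "nonstandard_universe mem num smem star"
    and "saturated mem num smem star lam"
    and "|hypernats mem num smem star| =o lam"
  shows "\<forall>H \<in> infinite_hypernats mem num smem star.
           compact_measure_space (loeb_space mem num smem star H)"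
proof
  fix H assume "H \<in> infinite_hypernats mem num smem star"
  then interpret hyperfinite_space mem num smem star H
    using assms(6) by unfold_locales (simp_all add: nonstandard_universe_def)
  interpret algebra Omega internal_subsets by (rule algebra_internal_subsets)
  have card_\<kappa>: "Card_order \<kappa>" using strong_limit_Cinfinite[OF assms(1)] by simp
  have "lam \<le>o |bit_positions|"
    using bit_positions_large[OF assms(7)] assms(3) card_of_Well_order[of bit_positions]
    by (simp add: card_order_on_def not_ordLess_iff_ordLeq)
  then have "cardSuc \<kappa> \<le>o |bit_positions|"
    by (rule ordIso_ordLeq_trans[OF ordIso_symmetric[OF assms(4)]])
  then have "\<kappa> \<le>o |bit_positions|"
    by (rule ordLeq_transitive[OF ordLess_imp_ordLeq[OF cardSuc_greater[OF card_\<kappa>]]])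
  then have "|Field \<kappa>| \<le>o |bit_positions|"
    by (rule ordIso_ordLeq_trans[OF card_of_Field_ordIso[OF card_\<kappa>]])
  from iffD2[OF card_of_ordLeq this] obtain h
    where h: "inj_on h (Field \<kappa>)" "h ` Field \<kappa> \<subseteq> bit_positions" by blast
  \<comment> \<open>Exactly \<kappa> of the available places are kept, so that \<open>2^K\<close>
    has only \<open>2^\<kappa>\<close> points, as many as \<open>lam\<close>.\<close>
  define K where "K = h ` Field \<kappa>"
  have "|Field \<kappa>| =o |K|"
    using h(1) by (intro card_of_ordIsoI[of h]) (simp add: K_def bij_betw_def)
  then have K: "|K| =o \<kappa>"
    using card_of_Field_ordIso[OF card_\<kappa>] by (rule ordIso_transitive[OF ordIso_symmetric])
  \<comment> \<open>The numerator is 4 = 2 + 2: one digit bound for the constant value 1 and one for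
    the constant value 0.\<close>
  have const: "{x \<in> Omega. (\<forall>i\<in>F. x \<in> bit_set i) \<or> (\<forall>i\<in>F. x \<notin> bit_set i)} \<in> internal_subsets \<and>
      loeb_content {x \<in> Omega. (\<forall>i\<in>F. x \<in> bit_set i) \<or> (\<forall>i\<in>F. x \<notin> bit_set i)} \<le> 4 / 2 ^ card F"
    (is "?C \<in> internal_subsets \<and> _") if F: "finite F" "F \<subseteq> K" for F
  proof -
    define C1 C0 where "C1 = {x \<in> Omega. \<forall>i\<in>F. x \<in> bit_set i}" and "C0 = {x \<in> Omega. \<forall>i\<in>F. x \<notin> bit_set i}"
    have eq: "C1 = Omega - (\<Union>i\<in>F. Omega - Omega \<inter> bit_set i)" "C0 = Omega - (\<Union>i\<in>F. Omega \<inter> bit_set i)"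
      by (auto simp: C1_def C0_def)
    have C_in: "C1 \<in> internal_subsets" "C0 \<in> internal_subsets"
      unfolding eq by (intro Diff top finite_UN F(1) bit_set_in_internal_subsets)+
    have "F \<subseteq> bit_positions" using F(2) h(2) by (auto simp: K_def)
    note le = loeb_content_le_bits[OF F(1) this]
    have C: "?C = C1 \<union> C0" by (auto simp: C1_def C0_def)
    have "loeb_content (C1 \<union> C0) \<le> 4 / 2 ^ card F"
    \<comment> \<open>For empty \<open>F\<close> both parts are all of \<open>Omega\<close>, so
      additivity for disjoint sets does not apply; there the content is 1, below the bound
      4.\<close>
    proof (cases "F = {}")
      case True
      then show ?thesis by (simp add: C1_def C0_def loeb_content_Omega)
    next
      case False
      then have "C1 \<inter> C0 = {}" by (auto simp: C1_def C0_def)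
      then have "loeb_content (C1 \<union> C0) = loeb_content C1 + loeb_content C0"
        using C_in by (intro loeb_content_add)
      then show ?thesis using le[OF C_in(1)] le[OF C_in(2)] by (simp add: C1_def C0_def)
    qed
    with Un[OF C_in] C show ?thesis by simp
  qed
  have sat: "\<Inter>\<G> \<noteq> {}" if "\<G> \<subseteq> internal_subsets" "|\<G>| <o lam" "fip \<G>" for \<G>
    using internal_subsets_saturated[OF assms(7) that] .
  have "|internal_subsets| \<le>o lam" using card_internal_subsets assms(8) by (rule ordLeq_ordIso_trans)
  from exists_dense_compact_family[OF assms(1-5) K this sat const] obtain \<C>
    where \<C>: "compact_family \<C>" "\<And>B e. range B \<subseteq> internal_subsets \<Longrightarrow> 0 < e \<Longrightarrow> \<exists>E. range E \<subseteq> internal_subsets \<and>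
      (\<forall>n. loeb_content (E n) \<le> e * (1 / 2) ^ Suc n) \<and> (\<Inter>n::nat. B n) - (\<Union>n::nat. E n) \<in> \<C>"
    by blast
  have "saturated mem num smem star (cardSuc natLeq)"
    using assms(6) by (simp add: nonstandard_universe_def)
  then have countably_compact: "\<Inter>\<G> \<noteq> {}" if "\<G> \<subseteq> internal_subsets" "countable \<G>" "fip \<G>" for \<G>
    using internal_subsets_saturated that countable_ordLess_cardSuc by blast
  show "compact_measure_space (loeb_space mem num smem star H)"
    unfolding loeb_space_eq
    by (rule compact_measure_spaceI[OF loeb_content_nonneg loeb_content_add countably_compact \<C>])
qed

end
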